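(* Let $E$ be a connected Brauer configuration with $n$ vertices $v_1,\ldots,v_n$. Let $k_l$ be the number of $l$-gons of $E$ for each $l\geq 2$. Let $d_i=d_f(v_i)$ be the f-degree of $v_i$ for each $1\leq i\leq n$, and let $r=\sum_{l\geq 2}(l-1)k_l-n+1$. Then the fundamental group of $E$ is isomorphic to $$F\langle a_1,\cdots,a_n,b_1,\cdots,b_r\rangle/\langle a_1^{d_1}=\cdots=a_n^{d_n},\ a_1^{d_1}b_1=b_1a_1^{d_1},\cdots,a_1^{d_1}b_r=b_ra_1^{d_1}\rangle,$$ where $F\langle a_1,\cdots,a_n,b_1,\cdots,b_r\rangle$ denotes the free group on the set $\{a_1,\cdots,a_n,b_1,\cdots,b_r\}$. In particular, the fundamental group of a connected Brauer configuration is finitely presented.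
   Context: Let $G=\langle g\rangle$ be a fixed infinite cyclic group. A fractional Brauer configuration (f-BC) is a quadruple $E=(E,P,L,d)$, where $E$ is a $G$-set, $P$ and $L$ are two partitions of $E$ (write $P(e)$, $L(e)$ for the classes containing $e\in E$), and $d:E\to\mathbb{Z}_{>0}$ is a function, such that: (f1) $L(e)\subseteq P(e)$ and $P(e)$ is a finite set for each $e\in E$; (f2) if $L(e_1)=L(e_2)$, then $P(g\cdot e_1)=P(g\cdot e_2)$; (f3) if $e_1,e_2$ belong to the same $G$-orbit, then $d(e_1)=d(e_2)$; (f4) $P(e_1)=P(e_2)$ if and only if $P(g^{d(e_1)}\cdot e_1)=P(g^{d(e_2)}\cdot e_2)$; (f5) $L(e_1)=L(e_2)$ if and only if $L(g^{d(e_1)}\cdot e_1)=L(g^{d(e_2)}\cdot e_2)$; (f6) the sequence $L(g^{d(e)-1}\cdot e)\cdots L(g\cdot e)L(e)$ is not a proper subsequence (block of consecutive terms) of $L(g^{d(h)-1}\cdot h)\cdots L(g\cdot h)L(h)$ for all $e,h\in E$. Elements of $E$ are angles; the vertices of $E$ are the $G$-orbits of $E$; the polygons are the sets $P(e)$, and $P(e)$ is an $l$-gon if $|P(e)|=l$. The f-degree of a finite vertex $v$ is $d_f(v)=d(v)/|v|$, where $d(v)$ is the common value of $d$ on $v$. A Brauer configuration is an f-BC with $E$ finite, $L(e)=\{e\}$ for all $e\in E$, all f-degrees integers, and no $1$-gons. A walk of $E$ is a sequence $w=(e_n|\delta_n|e_{n-1})\cdots(e_1|\delta_1|e_0)$ with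 $e_i\in E$, $\delta_i\in\{g,g^{-1},\tau\}$, such that $e_i=g\cdot e_{i-1}$ if $\delta_i=g$, $e_i=g^{-1}\cdot e_{i-1}$ if $\delta_i=g^{-1}$, $P(e_i)=P(e_{i-1})$ if $\delta_i=\tau$; abbreviated $(e_n|\delta_n\cdots\delta_1|e_0)$; $(e||e)$ is the trivial walk. Composition $uv$ is concatenation when the terminal of $v$ is the source of $u$. $E$ is connected if any two angles can be connected by a walk. Homotopy $\sim$ is the smallest equivalence relation on walks with: (h1) $(e|g^{-1}g|e)\sim(e|gg^{-1}|e)\sim(e|\tau|e)\sim(e||e)$; (h2) $(e_2|\tau|e_1)(e_1|\tau|e_0)\sim(e_2|\tau|e_0)$; (h3) $(g^{d(h)}\cdot h|\tau|g^{d(e)}\cdot e)(g^{d(e)}\cdot e|g^{d(e)}|e)\sim(g^{d(h)}\cdot h|g^{d(h)}|h)(h|\tau|e)$ whenever $P(e)=P(h)$; (h4) $(g\cdot h|\tau|g\cdot e)(g\cdot e|g|e)\sim(g\cdot h|g|h)(h|\tau|e)$ whenever $L(e)=L(h)$; (h5) compatibility with composition on both sides. The fundamental group of a connected f-BC $E$ is the group $\Pi(E,e)$ of homotopy classes of closed walks at $e\in E$; up to isomorphism it does not depend on $e$. *)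

theory Defs
  imports
    Complex_Main
    "HOL-Library.Disjoint_Sets"
    "HOL-Library.Sublist"
    "HOL-Algebra.Coset"
    "HOL-Algebra.Elementary_Groups"
    "HOL-Algebra.Group_Action"
begin

section \<open>Fractional Brauer configurations\<close>

text \<open>
  The infinite cyclic group is \<^const>\<open>integer_group\<close> with generator \<open>g = 1\<close>, so that
  \<open>act E k e\<close> is the angle \<open>g\<^sup>k \<cdot> e\<close>.
\<close>

record 'a fbc =
  angles :: "'a set"
  act :: "int \<Rightarrow> 'a \<Rightarrow> 'a"
  polygons :: "'a set set"
  lparts :: "'a set set"
  dval :: "'a \<Rightarrow> nat"

definition part_of :: "'a set set \<Rightarrow> 'a \<Rightarrow> 'a set" where
  "part_of Q e = (THE q. q \<in> Q \<and> e \<in> q)"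

abbreviation polygon :: "'a fbc \<Rightarrow> 'a \<Rightarrow> 'a set" where
  "polygon E \<equiv> part_of (polygons E)"

abbreviation lpart :: "'a fbc \<Rightarrow> 'a \<Rightarrow> 'a set" where
  "lpart E \<equiv> part_of (lparts E)"

definition vertices :: "'a fbc \<Rightarrow> 'a set set" where
  "vertices E = orbits integer_group (angles E) (act E)"

text \<open>The sequence \<open>L(g\<^bsup>d(e)-1\<^esup> \<cdot> e) \<dots> L(g \<cdot> e) L(e)\<close>.\<close>

definition lpart_seq :: "'a fbc \<Rightarrow> 'a \<Rightarrow> 'a set list" where
  "lpart_seq E e = map (\<lambda>i. lpart E (act E (int i) e)) (rev [0..<dval E e])"

locale fractional_brauer_configuration =
  fixes E :: "'a fbc"
  assumes action: "group_action integer_group (angles E) (act E)"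
    and partition_P: "partition_on (angles E) (polygons E)"
    and partition_L: "partition_on (angles E) (lparts E)"
    and dval_pos: "e \<in> angles E \<Longrightarrow> 0 < dval E e"
    and f1: "e \<in> angles E \<Longrightarrow> lpart E e \<subseteq> polygon E e \<and> finite (polygon E e)"
    and f2: "\<lbrakk>e\<^sub>1 \<in> angles E; e\<^sub>2 \<in> angles E; lpart E e\<^sub>1 = lpart E e\<^sub>2\<rbrakk>
      \<Longrightarrow> polygon E (act E 1 e\<^sub>1) = polygon E (act E 1 e\<^sub>2)"
    and f3: "\<lbrakk>v \<in> vertices E; e\<^sub>1 \<in> v; e\<^sub>2 \<in> v\<rbrakk> \<Longrightarrow> dval E e\<^sub>1 = dval E e\<^sub>2"
    and f4: "\<lbrakk>e\<^sub>1 \<in> angles E; e\<^sub>2 \<in> angles E\<rbrakk> \<Longrightarrow>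
      polygon E e\<^sub>1 = polygon E e\<^sub>2 \<longleftrightarrow>
      polygon E (act E (int (dval E e\<^sub>1)) e\<^sub>1) = polygon E (act E (int (dval E e\<^sub>2)) e\<^sub>2)"
    and f5: "\<lbrakk>e\<^sub>1 \<in> angles E; e\<^sub>2 \<in> angles E\<rbrakk> \<Longrightarrow>
      lpart E e\<^sub>1 = lpart E e\<^sub>2 \<longleftrightarrow>
      lpart E (act E (int (dval E e\<^sub>1)) e\<^sub>1) = lpart E (act E (int (dval E e\<^sub>2)) e\<^sub>2)"
    and f6: "\<lbrakk>e \<in> angles E; h \<in> angles E\<rbrakk> \<Longrightarrow>
      \<not> strict_sublist (lpart_seq E e) (lpart_seq E h)"

text \<open>
  On a vertex the function \<open>d\<close> is constant by \<open>f3\<close>; \<^const>\<open>the_elem\<close> picks its value.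
\<close>

definition f_degree :: "'a fbc \<Rightarrow> 'a set \<Rightarrow> rat" where
  "f_degree E v = of_nat (the_elem (dval E ` v)) / of_nat (card v)"

locale brauer_configuration = fractional_brauer_configuration +
  assumes finite_angles: "finite (angles E)"
    and lpart_singleton: "e \<in> angles E \<Longrightarrow> lpart E e = {e}"
    and f_degree_integer: "v \<in> vertices E \<Longrightarrow> f_degree E v \<in> \<int>"
    and no_1_gon: "p \<in> polygons E \<Longrightarrow> card p \<noteq> 1"


section \<open>Walks, homotopy and the fundamental group\<close>

datatype step = Act | ActInv | Tau

text \<open>
  \<open>Triv e\<close> is the trivial walk \<open>(e||e)\<close>, and \<open>Step e \<delta> w\<close> is the walk \<open>(e|\<delta>|e')w\<close> where \<open>e'\<close>
  is the terminal of \<open>w\<close>.  Walks are thus written from right to left.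
\<close>

datatype 'a walk = Triv 'a | Step 'a step "'a walk"

primrec source :: "'a walk \<Rightarrow> 'a" where
  "source (Triv e) = e"
| "source (Step e \<delta> w) = source w"

primrec terminal :: "'a walk \<Rightarrow> 'a" where
  "terminal (Triv e) = e"
| "terminal (Step e \<delta> w) = e"

primrec comp_walk :: "'a walk \<Rightarrow> 'a walk \<Rightarrow> 'a walk" (infixr "\<cdot>" 70) where
  "Triv e \<cdot> w = w"
| "Step e \<delta> u \<cdot> w = Step e \<delta> (u \<cdot> w)"

fun is_step :: "'a fbc \<Rightarrow> 'a \<Rightarrow> step \<Rightarrow> 'a \<Rightarrow> bool" where
  "is_step E e' Act e \<longleftrightarrow> e' = act E 1 e"
| "is_step E e' ActInv e \<longleftrightarrow> e' = act E (- 1) e"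
| "is_step E e' Tau e \<longleftrightarrow> polygon E e' = polygon E e"

primrec is_walk :: "'a fbc \<Rightarrow> 'a walk \<Rightarrow> bool" where
  "is_walk E (Triv e) \<longleftrightarrow> e \<in> angles E"
| "is_walk E (Step e \<delta> w) \<longleftrightarrow> e \<in> angles E \<and> is_step E e \<delta> (terminal w) \<and> is_walk E w"

definition connected_fbc :: "'a fbc \<Rightarrow> bool" where
  "connected_fbc E \<longleftrightarrow>
     (\<forall>e\<in>angles E. \<forall>h\<in>angles E. \<exists>w. is_walk E w \<and> source w = e \<and> terminal w = h)"

text \<open>The walk \<open>(g\<^sup>k \<cdot> e|g\<^sup>k|e)\<close>.\<close>

primrec g_walk :: "'a fbc \<Rightarrow> nat \<Rightarrow> 'a \<Rightarrow> 'a walk" where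
  "g_walk E 0 e = Triv e"
| "g_walk E (Suc k) e = Step (act E (int (Suc k)) e) Act (g_walk E k e)"

abbreviation tau_walk :: "'a \<Rightarrow> 'a \<Rightarrow> 'a walk" where
  "tau_walk e' e \<equiv> Step e' Tau (Triv e)"

inductive homotopic :: "'a fbc \<Rightarrow> 'a walk \<Rightarrow> 'a walk \<Rightarrow> bool" for E :: "'a fbc" where
  refl: "is_walk E w \<Longrightarrow> homotopic E w w"
| sym: "homotopic E u w \<Longrightarrow> homotopic E w u"
| trans: "\<lbrakk>homotopic E u v; homotopic E v w\<rbrakk> \<Longrightarrow> homotopic E u w"
| h1_left: "e \<in> angles E \<Longrightarrow>
    homotopic E (Step e ActInv (Step (act E 1 e) Act (Triv e))) (Triv e)"
| h1_right: "e \<in> angles E \<Longrightarrow>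
    homotopic E (Step e Act (Step (act E (- 1) e) ActInv (Triv e))) (Triv e)"
| h1_tau: "e \<in> angles E \<Longrightarrow> homotopic E (tau_walk e e) (Triv e)"
| h2: "\<lbrakk>e\<^sub>0 \<in> angles E; e\<^sub>1 \<in> angles E; e\<^sub>2 \<in> angles E;
    polygon E e\<^sub>1 = polygon E e\<^sub>0; polygon E e\<^sub>2 = polygon E e\<^sub>1\<rbrakk> \<Longrightarrow>
    homotopic E (tau_walk e\<^sub>2 e\<^sub>1 \<cdot> tau_walk e\<^sub>1 e\<^sub>0) (tau_walk e\<^sub>2 e\<^sub>0)"
| h3: "\<lbrakk>e \<in> angles E; h \<in> angles E; polygon E e = polygon E h\<rbrakk> \<Longrightarrow>
    homotopic E
      (tau_walk (act E (int (dval E h)) h) (act E (int (dval E e)) e) \<cdot> g_walk E (dval E e) e)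
      (g_walk E (dval E h) h \<cdot> tau_walk h e)"
| h4: "\<lbrakk>e \<in> angles E; h \<in> angles E; lpart E e = lpart E h\<rbrakk> \<Longrightarrow>
    homotopic E
      (tau_walk (act E 1 h) (act E 1 e) \<cdot> g_walk E 1 e)
      (g_walk E 1 h \<cdot> tau_walk h e)"
| h5_left: "\<lbrakk>homotopic E u v; is_walk E w; source w = terminal u; source w = terminal v\<rbrakk> \<Longrightarrow>
    homotopic E (w \<cdot> u) (w \<cdot> v)"
| h5_right: "\<lbrakk>homotopic E u v; is_walk E w; terminal w = source u; terminal w = source v\<rbrakk> \<Longrightarrow>
    homotopic E (u \<cdot> w) (v \<cdot> w)"

definition homotopy_rel :: "'a fbc \<Rightarrow> ('a walk \<times> 'a walk) set" where
  "homotopy_rel E = {(u, w). homotopic E u w}"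

definition closed_walks :: "'a fbc \<Rightarrow> 'a \<Rightarrow> 'a walk set" where
  "closed_walks E e = {w. is_walk E w \<and> source w = e \<and> terminal w = e}"

definition fundamental_group :: "'a fbc \<Rightarrow> 'a \<Rightarrow> 'a walk set monoid" where
  "fundamental_group E e =
     \<lparr>carrier = closed_walks E e // homotopy_rel E,
      mult = (\<lambda>X Y. \<Union>u\<in>X. \<Union>w\<in>Y. homotopy_rel E `` {u \<cdot> w}),
      one = homotopy_rel E `` {Triv e}\<rparr>"


section \<open>Free groups and presentations\<close>

text \<open>
  Words in the letters \<open>x\<close> and \<open>x\<^sup>-\<^sup>1\<close> for \<open>x \<in> S\<close>; the letter \<open>x\<close> is \<open>(x, True)\<close> and
  \<open>x\<^sup>-\<^sup>1\<close> is \<open>(x, False)\<close>.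
\<close>

type_synonym 'x word = "('x \<times> bool) list"

definition words :: "'x set \<Rightarrow> 'x word set" where
  "words S = lists (S \<times> UNIV)"

inductive free_equiv :: "'x set \<Rightarrow> 'x word \<Rightarrow> 'x word \<Rightarrow> bool" for S :: "'x set" where
  refl: "u \<in> words S \<Longrightarrow> free_equiv S u u"
| sym: "free_equiv S u v \<Longrightarrow> free_equiv S v u"
| trans: "\<lbrakk>free_equiv S u v; free_equiv S v w\<rbrakk> \<Longrightarrow> free_equiv S u w"
| cancel: "\<lbrakk>u \<in> words S; v \<in> words S; x \<in> S\<rbrakk> \<Longrightarrow>
    free_equiv S (u @ [(x, b), (x, \<not> b)] @ v) (u @ v)"

definition free_rel :: "'x set \<Rightarrow> ('x word \<times> 'x word) set" where
  "free_rel S = {(u, v). free_equiv S u v}"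

definition free_group :: "'x set \<Rightarrow> 'x word set monoid" where
  "free_group S =
     \<lparr>carrier = words S // free_rel S,
      mult = (\<lambda>X Y. \<Union>u\<in>X. \<Union>v\<in>Y. free_rel S `` {u @ v}),
      one = free_rel S `` {[]}\<rparr>"

definition free_gen :: "'x set \<Rightarrow> 'x \<Rightarrow> 'x word set" where
  "free_gen S x = free_rel S `` {[(x, True)]}"

definition normal_closure :: "('g, 'm) monoid_scheme \<Rightarrow> 'g set \<Rightarrow> 'g set" where
  "normal_closure H R = \<Inter>{N. N \<lhd> H \<and> R \<subseteq> N}"

text \<open>A pair \<open>(u, v) \<in> R\<close> of elements of the free group stands for the relation \<open>u = v\<close>.\<close>

definition presented_group ::
    "'x set \<Rightarrow> ('x word set \<times> 'x word set) set \<Rightarrow> 'x word set set monoid" where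
  "presented_group S R = free_group S Mod
     normal_closure (free_group S) {u \<otimes>\<^bsub>free_group S\<^esub> inv\<^bsub>free_group S\<^esub> v | u v. (u, v) \<in> R}"

definition finitely_presented :: "('g, 'm) monoid_scheme \<Rightarrow> bool" where
  "finitely_presented H \<longleftrightarrow>
     (\<exists>(S :: nat set) R. finite S \<and> finite R \<and>
        R \<subseteq> carrier (free_group S) \<times> carrier (free_group S) \<and> H \<cong> presented_group S R)"

datatype gen = GenA nat | GenB nat

definition brauer_gens :: "nat \<Rightarrow> nat \<Rightarrow> gen set" where
  "brauer_gens n r = GenA ` {1..n} \<union> GenB ` {1..r}"

definition brauer_rels ::
    "nat \<Rightarrow> nat \<Rightarrow> (nat \<Rightarrow> nat) \<Rightarrow> (gen word set \<times> gen word set) set" where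
  "brauer_rels n r d =
     (let F = free_group (brauer_gens n r);
          a = (\<lambda>i. free_gen (brauer_gens n r) (GenA i));
          b = (\<lambda>j. free_gen (brauer_gens n r) (GenB j))
      in {(a i [^]\<^bsub>F\<^esub> d i, a (Suc i) [^]\<^bsub>F\<^esub> d (Suc i)) | i. 1 \<le> i \<and> i < n} \<union>
         {(a 1 [^]\<^bsub>F\<^esub> d 1 \<otimes>\<^bsub>F\<^esub> b j, b j \<otimes>\<^bsub>F\<^esub> a 1 [^]\<^bsub>F\<^esub> d 1) | j. 1 \<le> j \<and> j \<le> r})"

end

theory Submission
  imports Defs
begin

text \<open>
  View the angles as the edges of a connected bipartite graph, whose nodes are the vertices and
  the polygons of \<open>E\<close>; a spanning tree \<open>T\<close> leaves out exactly \<open>r\<close> angles.  Sending every full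
  round about the vertex \<open>v\<^sub>i\<close> to \<open>a\<^sub>i\<close> and every crossing of the \<open>j\<close>-th angle outside \<open>T\<close> to
  \<open>b\<^sub>j\<close> labels each walk by an element of the presented group.  As the \<open>L\<close>-parts are singletons
  and \<open>g\<^bsup>d(e)\<^esup> \<cdot> e = e\<close>, the only homotopy relation that matters is \<open>h3\<close>; it says that the loops
  \<open>(e|g\<^bsup>d(e)\<^esup>|e)\<close> form a natural, hence central, family, which is what the relations of the
  presentation express.  Conversely, connecting every angle to the base point inside \<open>T\<close> turns
  each walk into a closed one, and these closed walks are products of rounds about vertices and of
  loops through the angles outside \<open>T\<close>, which gives the inverse homomorphism.
\<close>

text \<open>A tree has one edge fewer than nodes, so with |P| polygons it omits |E| - (n + |P|) + 1
  angles; as |E| is the sum of the polygon sizes, this is \<open>r\<close>, which is therefore never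
  negative. The obstacle is that walks turn by single g steps while a generator a_i stands for a
  whole round. Each orbit is therefore cut at a chosen base angle: only the step returning to it
  carries the generator. This fits tree paths that reach an angle by turning from the base angle of
  its vertex. Every angle is reached in two ways, through its vertex and through its polygon. For
  angles in T the two paths are homotopic; for the others they enclose the loop b_j. No normal forms
  of words or walks are used. Closing up walks along the tree is itself a labelling, with values in
  the fundamental group, and the homomorphism from the presented group carries one labelling to the
  other.\<close>

section \<open>Free groups and presentations\<close>

lemma free_equiv_words: "free_equiv S u v \<Longrightarrow> u \<in> words S \<and> v \<in> words S"
  by (induction rule: free_equiv.induct) (auto simp: words_def)

lemma equiv_free_rel: "equiv (words S) (free_rel S)"
proof (rule equivI)
  show "free_rel S \<subseteq> words S \<times> words S" using free_equiv_words by (auto simp: free_rel_def)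
  show "refl_on (words S) (free_rel S)" by (auto simp: refl_on_def free_rel_def free_equiv.refl)
  show "sym (free_rel S)" by (auto simp: sym_def free_rel_def intro: free_equiv.sym)
  show "trans (free_rel S)" by (auto simp: trans_def free_rel_def intro: free_equiv.trans)
qed

lemma words_append [simp]: "u @ v \<in> words S \<longleftrightarrow> u \<in> words S \<and> v \<in> words S"
  by (auto simp: words_def)

lemma words_Nil [simp]: "[] \<in> words S"
  by (simp add: words_def)

lemma words_Cons [simp]: "(x, b) # w \<in> words S \<longleftrightarrow> x \<in> S \<and> w \<in> words S"
  by (auto simp: words_def)

lemma free_equiv_append_left:
  "\<lbrakk>free_equiv S u v; w \<in> words S\<rbrakk> \<Longrightarrow> free_equiv S (w @ u) (w @ v)"
proof (induction rule: free_equiv.induct)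
  case (cancel u v x b)
  then show ?case using free_equiv.cancel[of "w @ u" S v x b] by simp
qed (auto intro: free_equiv.intros)

lemma free_equiv_append_right:
  "\<lbrakk>free_equiv S u v; w \<in> words S\<rbrakk> \<Longrightarrow> free_equiv S (u @ w) (v @ w)"
proof (induction rule: free_equiv.induct)
  case (cancel u v x b)
  then show ?case using free_equiv.cancel[of u S "v @ w" x b] by simp
qed (auto intro: free_equiv.intros)

lemma free_class_eq_iff:
  "\<lbrakk>u \<in> words S; v \<in> words S\<rbrakk> \<Longrightarrow>
    free_rel S `` {u} = free_rel S `` {v} \<longleftrightarrow> free_equiv S u v"
  using eq_equiv_class_iff[OF equiv_free_rel] by (force simp: free_rel_def)

text \<open>The union over all representatives in \<open>free_group\<close> collapses to one class
  because \<open>free_equiv\<close> is a congruence for concatenation.\<close>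

lemma free_group_mult:
  assumes "u \<in> words S" "v \<in> words S"
  shows "free_rel S `` {u} \<otimes>\<^bsub>free_group S\<^esub> free_rel S `` {v} = free_rel S `` {u @ v}"
proof -
  have "free_rel S `` {u' @ v'} = free_rel S `` {u @ v}"
    if "free_equiv S u u'" "free_equiv S v v'" for u' v'
  proof -
    have "free_equiv S (u @ v) (u' @ v')"
      using that assms free_equiv_words[OF that(1)]
      by (meson free_equiv.trans free_equiv_append_left free_equiv_append_right)
    then show ?thesis
      using assms that free_equiv_words by (metis free_class_eq_iff words_append)
  qed
  then have "(\<Union>u'\<in>free_rel S `` {u}. \<Union>v'\<in>free_rel S `` {v}. free_rel S `` {u' @ v'}) =
      (\<Union>u'\<in>free_rel S `` {u}. \<Union>v'\<in>free_rel S `` {v}. free_rel S `` {u @ v})"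
    by (intro SUP_cong) (auto simp: free_rel_def)
  moreover have "u \<in> free_rel S `` {u}" "v \<in> free_rel S `` {v}"
    using assms by (auto simp: free_rel_def intro: free_equiv.refl)
  ultimately show ?thesis
    unfolding free_group_def by auto
qed

lemma free_class_in_carrier [simp]:
  "w \<in> words S \<Longrightarrow> free_rel S `` {w} \<in> carrier (free_group S)"
  by (simp add: free_group_def quotientI)

lemma free_group_carrierE:
  assumes "x \<in> carrier (free_group S)"
  obtains w where "w \<in> words S" "x = free_rel S `` {w}"
  using assms by (auto simp: free_group_def elim: quotientE)

lemma one_free_group: "\<one>\<^bsub>free_group S\<^esub> = free_rel S `` {[]}"
  by (simp add: free_group_def)

text \<open>A left inverse is all that \<open>groupI\<close> asks for: a letter put in front of
  \<open>w\<close> is met by its inverse at the right end of \<open>w'\<close>.\<close>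

lemma inverse_word_cancel:
  assumes "w \<in> words S"
  shows "\<exists>w' \<in> words S. free_equiv S (w' @ w) []"
  using assms
proof (induction w)
  case Nil
  then show ?case by (auto intro!: bexI[of _ "[]"] free_equiv.refl)
next
  case (Cons xb w)
  obtain x b where xb: "xb = (x, b)" by force
  with Cons obtain w' where w': "w' \<in> words S" "free_equiv S (w' @ w) []" by auto
  have "free_equiv S (w' @ [(x, \<not> b), (x, \<not> \<not> b)] @ w) (w' @ w)"
    using free_equiv.cancel[of w' S w x "\<not> b"] w' Cons xb by auto
  then show ?case
    using w' Cons.prems xb by (intro bexI[of _ "w' @ [(x, \<not> b)]"]) (auto intro: free_equiv.trans)
qed

lemma group_free_group: "group (free_group S)"
proof (rule groupI)
  fix x y assume "x \<in> carrier (free_group S)" "y \<in> carrier (free_group S)"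
  then show "x \<otimes>\<^bsub>free_group S\<^esub> y \<in> carrier (free_group S)"
    by (auto elim!: free_group_carrierE simp: free_group_mult)
next
  fix x assume "x \<in> carrier (free_group S)"
  then obtain w where w: "w \<in> words S" "x = free_rel S `` {w}" by (rule free_group_carrierE)
  then obtain w' where w': "w' \<in> words S" "free_equiv S (w' @ w) []"
    using inverse_word_cancel by blast
  have "free_rel S `` {w'} \<otimes>\<^bsub>free_group S\<^esub> x = \<one>\<^bsub>free_group S\<^esub>"
    using w w' by (simp add: free_group_mult free_class_eq_iff one_free_group)
  then show "\<exists>y\<in>carrier (free_group S). y \<otimes>\<^bsub>free_group S\<^esub> x = \<one>\<^bsub>free_group S\<^esub>"
    using w' free_class_in_carrier by blast
qed (auto elim!: free_group_carrierE simp: free_group_mult one_free_group)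

lemma free_gen_in_carrier [simp]: "x \<in> S \<Longrightarrow> free_gen S x \<in> carrier (free_group S)"
  by (simp add: free_gen_def)

section \<open>Universal property of the free group\<close>

definition word_eval :: "('g, 'm) monoid_scheme \<Rightarrow> ('x \<Rightarrow> 'g) \<Rightarrow> 'x word \<Rightarrow> 'g" where
  "word_eval K f w =
     foldr (\<lambda>(x, b) z. (if b then f x else inv\<^bsub>K\<^esub> (f x)) \<otimes>\<^bsub>K\<^esub> z) w \<one>\<^bsub>K\<^esub>"

lemma word_eval_Nil [simp]: "word_eval K f [] = \<one>\<^bsub>K\<^esub>"
  and word_eval_Cons [simp]: "word_eval K f ((x, b) # w) =
    (if b then f x else inv\<^bsub>K\<^esub> (f x)) \<otimes>\<^bsub>K\<^esub> word_eval K f w"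
  by (simp_all add: word_eval_def)

lemma (in group) word_eval_closed:
  assumes "f \<in> S \<rightarrow> carrier G" "w \<in> words S"
  shows "word_eval G f w \<in> carrier G"
  using assms(2)
proof (induction w)
  case (Cons xb w)
  then show ?case using assms(1) by (cases xb) auto
qed simp

lemma (in group) word_eval_append:
  assumes f: "f \<in> S \<rightarrow> carrier G" and "u \<in> words S" and v: "v \<in> words S"
  shows "word_eval G f (u @ v) = word_eval G f u \<otimes> word_eval G f v"
  using assms(2)
proof (induction u)
  case Nil
  then show ?case using word_eval_closed[OF f v] by simp
next
  case (Cons xb u)
  obtain x b where xb: "xb = (x, b)" by force
  have "f x \<in> carrier G" using f Cons.prems xb by auto
  then show ?case using Cons xb word_eval_closed[OF f] v by (auto simp: m_assoc)
qed

lemma (in group) word_eval_free_equiv: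
  assumes f: "f \<in> S \<rightarrow> carrier G" and "free_equiv S u v"
  shows "word_eval G f u = word_eval G f v"
  using assms(2)
proof (induction rule: free_equiv.induct)
  case (cancel u v x b)
  have "f x \<in> carrier G" using f cancel by auto
  then have "word_eval G f ([(x, b), (x, \<not> b)] @ v) = word_eval G f v"
    using word_eval_closed[OF f cancel(2)] by (auto simp: m_assoc[symmetric])
  moreover have "word_eval G f (u @ [(x, b), (x, \<not> b)] @ v) =
      word_eval G f u \<otimes> word_eval G f ([(x, b), (x, \<not> b)] @ v)"
    using cancel by (intro word_eval_append[OF f]) auto
  ultimately show ?case
    using cancel by (simp add: word_eval_append[OF f])
qed auto

lemma (in group) free_group_lift:
  assumes f: "f \<in> S \<rightarrow> carrier G"
  obtains h where "h \<in> hom (free_group S) G" "\<And>x. x \<in> S \<Longrightarrow> h (free_gen S x) = f x"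
proof
  \<comment> \<open>Any representative will do, as evaluation is constant on classes by
    \<open>word_eval_free_equiv\<close>.\<close>
  define h where "h X = word_eval G f (SOME w. w \<in> X)" for X
  have h: "h (free_rel S `` {w}) = word_eval G f w" if "w \<in> words S" for w
  proof -
    have "w \<in> free_rel S `` {w}" using that by (auto simp: free_rel_def free_equiv.refl)
    then have "(SOME u. u \<in> free_rel S `` {w}) \<in> free_rel S `` {w}" by (rule someI)
    then show ?thesis
      unfolding h_def using word_eval_free_equiv[OF f] by (auto simp: free_rel_def)
  qed
  show "h \<in> hom (free_group S) G"
    by (rule homI) (auto elim!: free_group_carrierE
        simp: h free_group_mult word_eval_closed[OF f] word_eval_append[OF f])
  show "h (free_gen S x) = f x" if "x \<in> S" for x
    using that funcset_mem[OF f that] by (simp add: free_gen_def h)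
qed

lemma free_group_hom_eq:
  assumes K: "group K" and h: "h \<in> hom (free_group S) K" and h': "h' \<in> hom (free_group S) K"
    and gens: "\<And>x. x \<in> S \<Longrightarrow> h (free_gen S x) = h' (free_gen S x)"
    and "y \<in> carrier (free_group S)"
  shows "h y = h' y"
proof -
  interpret h: group_hom "free_group S" K h
    using K h group_free_group by (simp add: group_hom_def group_hom_axioms_def)
  interpret h': group_hom "free_group S" K h'
    using K h' group_free_group by (simp add: group_hom_def group_hom_axioms_def)
  have letter: "h (free_rel S `` {[(x, b)]}) = h' (free_rel S `` {[(x, b)]})" if x: "x \<in> S" for x b
  proof (cases b)
    case True
    then show ?thesis using gens[OF x] by (simp add: free_gen_def)
  next
    case False
    have "free_equiv S ([] @ [(x, False), (x, \<not> False)] @ []) ([] @ [])"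
      by (rule free_equiv.cancel) (use x in auto)
    then have "free_rel S `` {[(x, False)]} \<otimes>\<^bsub>free_group S\<^esub> free_gen S x = \<one>\<^bsub>free_group S\<^esub>"
      using x by (simp add: free_gen_def free_group_mult one_free_group free_class_eq_iff)
    then have "free_rel S `` {[(x, False)]} = inv\<^bsub>free_group S\<^esub> free_gen S x"
      using x group.inv_equality[OF group_free_group] by fastforce
    then show ?thesis using False x gens[OF x] by simp
  qed
  obtain w where "w \<in> words S" and y: "y = free_rel S `` {w}"
    using assms(5) by (rule free_group_carrierE)
  from this(1) have "h (free_rel S `` {w}) = h' (free_rel S `` {w})"
  proof (induction w)
    case Nil
    then show ?case using h.hom_one h'.hom_one by (simp add: one_free_group)
  next
    case (Cons xb w)
    obtain x b where xb: "xb = (x, b)" by force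
    have "free_rel S `` {xb # w} =
        free_rel S `` {[(x, b)]} \<otimes>\<^bsub>free_group S\<^esub> free_rel S `` {w}"
      using Cons.prems xb by (simp add: free_group_mult)
    then show ?case using Cons xb letter by simp
  qed
  then show ?thesis using y by simp
qed

section \<open>Normal closures and quotients by relators\<close>

lemma (in group) normal_closure_normal:
  assumes "R \<subseteq> carrier G"
  shows "normal_closure G R \<lhd> G"
proof -
  have "carrier G \<lhd> G" by (simp add: normal_inv_iff subgroup_self)
  \<comment> \<open>The intersection of an empty family would be \<open>UNIV\<close>, so the family
    must be seen to be nonempty.\<close>
  then have ne: "{N. N \<lhd> G \<and> R \<subseteq> N} \<noteq> {}" using assms by blast
  show ?thesis
    unfolding normal_inv_iff[of "normal_closure G R"] unfolding normal_closure_def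
  proof (intro conjI ballI)
    show "subgroup (\<Inter> {N. N \<lhd> G \<and> R \<subseteq> N}) G"
      by (rule subgroups_Inter[OF _ ne]) (auto simp: normal_inv_iff)
    show "x \<otimes> h \<otimes> inv x \<in> \<Inter> {N. N \<lhd> G \<and> R \<subseteq> N}"
      if "x \<in> carrier G" "h \<in> \<Inter> {N. N \<lhd> G \<and> R \<subseteq> N}" for x h
      using that by (auto intro: normal.inv_op_closed2)
  qed
qed

lemma normal_closure_subset: "R \<subseteq> normal_closure G R"
  by (auto simp: normal_closure_def)

definition presentation_proj ::
    "'x set \<Rightarrow> ('x word set \<times> 'x word set) set \<Rightarrow> 'x word set \<Rightarrow> 'x word set set" where
  "presentation_proj S R x =
     normal_closure (free_group S) {u \<otimes>\<^bsub>free_group S\<^esub> inv\<^bsub>free_group S\<^esub> v | u v. (u, v) \<in> R}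
       #>\<^bsub>free_group S\<^esub> x"

locale presentation =
  fixes S :: "'x set" and R :: "('x word set \<times> 'x word set) set"
  assumes rels: "R \<subseteq> carrier (free_group S) \<times> carrier (free_group S)"
begin

abbreviation "F \<equiv> free_group S"
abbreviation "P \<equiv> presented_group S R"
abbreviation "\<pi> \<equiv> presentation_proj S R"
abbreviation "relators \<equiv> {u \<otimes>\<^bsub>F\<^esub> inv\<^bsub>F\<^esub> v | u v. (u, v) \<in> R}"

sublocale F: group F
  by (rule group_free_group)

lemma relators_normal: "normal_closure F relators \<lhd> F"
  using rels by (intro F.normal_closure_normal) auto

sublocale P: group P
  unfolding presented_group_def by (rule normal.factorgroup_is_group[OF relators_normal])

lemma proj_hom: "\<pi> \<in> hom F P"
  unfolding presented_group_def presentation_proj_def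
  using normal.r_coset_hom_Mod[OF relators_normal] by simp

sublocale proj: group_hom F P \<pi>
  by unfold_locales (rule proj_hom)

lemma proj_surj: "\<pi> ` carrier F = carrier P"
  by (simp add: presented_group_def carrier_FactGroup presentation_proj_def)

lemma proj_rel:
  assumes "(u, v) \<in> R"
  shows "\<pi> u = \<pi> v"
proof -
  have uv: "u \<in> carrier F" "v \<in> carrier F" using assms rels by auto
  have "u \<otimes>\<^bsub>F\<^esub> inv\<^bsub>F\<^esub> v \<in> normal_closure F relators"
    using assms normal_closure_subset[of relators F] by blast
  then have "\<pi> (u \<otimes>\<^bsub>F\<^esub> inv\<^bsub>F\<^esub> v) = \<one>\<^bsub>P\<^esub>"
    unfolding presentation_proj_def presented_group_def one_FactGroup
    using uv by (intro F.coset_join2 normal_imp_subgroup[OF relators_normal]) auto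
  then have "\<pi> u \<otimes>\<^bsub>P\<^esub> inv\<^bsub>P\<^esub> (\<pi> v) = \<one>\<^bsub>P\<^esub>" using uv by simp
  then show ?thesis using uv by (metis P.inv_equality P.inv_inv P.inv_closed proj.hom_closed)
qed

text \<open>Von Dyck's theorem: the kernel of \<open>h\<close> is normal and contains the relators,
  hence their normal closure, so \<open>h\<close> factors through the quotient.\<close>

lemma lift:
  assumes K: "group K" and h: "h \<in> hom F K" and rel: "\<And>u v. (u, v) \<in> R \<Longrightarrow> h u = h v"
  obtains g where "g \<in> hom P K" "\<And>x. x \<in> carrier F \<Longrightarrow> g (\<pi> x) = h x"
proof -
  interpret h: group_hom F K h
    using K h by (simp add: group_hom_def group_hom_axioms_def)
  have "relators \<subseteq> kernel F K h"
    using rels rel by (auto simp: kernel_def)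
  then have "normal_closure F relators \<subseteq> kernel F K h"
    unfolding normal_closure_def using h.normal_kernel by blast
  with h.FactGroup_universal_kernel[OF relators_normal] show thesis
    using that unfolding presented_group_def presentation_proj_def by blast
qed

text \<open>\<open>\<phi> \<circ> \<psi> \<circ> \<pi>\<close> and \<open>\<pi>\<close> are both
  homomorphisms on the free group, so comparing them on generators is enough; surjectivity of
  \<open>\<pi>\<close> then settles all of \<open>P\<close>.\<close>

lemma iso_of_inverse_on_gens:
  assumes K: "group K" and \<phi>: "\<phi> \<in> hom K P" and \<psi>: "\<psi> \<in> hom P K"
    and \<psi>\<phi>: "\<And>x. x \<in> carrier K \<Longrightarrow> \<psi> (\<phi> x) = x"
    and \<phi>\<psi>: "\<And>s. s \<in> S \<Longrightarrow> \<phi> (\<psi> (\<pi> (free_gen S s))) = \<pi> (free_gen S s)"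
  shows "K \<cong> P"
proof -
  have "(\<phi> \<circ> \<psi> \<circ> \<pi>) x = \<pi> x" if "x \<in> carrier F" for x
  proof (rule free_group_hom_eq[OF P.is_group _ proj_hom _ that])
    show "\<phi> \<circ> \<psi> \<circ> \<pi> \<in> hom F P"
      using \<phi> \<psi> proj_hom by (meson Group.hom_compose)
  qed (use \<phi>\<psi> in auto)
  then have "\<phi> (\<psi> y) = y" if "y \<in> carrier P" for y
    using that unfolding proj_surj[symmetric] by (auto simp del: proj_surj)
  then have "group_isomorphisms K P \<phi> \<psi>"
    using \<phi> \<psi> \<psi>\<phi> by (simp add: group_isomorphisms_def)
  then show ?thesis using group_isomorphisms_imp_iso is_isoI by blast
qed

end

section \<open>The groupoid of walks\<close>

lemma source_comp [simp]: "source (u \<cdot> w) = source w"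
  by (induction u) auto

lemma terminal_comp [simp]: "source u = terminal w \<Longrightarrow> terminal (u \<cdot> w) = terminal u"
  by (cases u) auto

lemma comp_walk_assoc [simp]: "(u \<cdot> v) \<cdot> w = u \<cdot> (v \<cdot> w)"
  by (induction u) auto

lemma comp_Triv [simp]: "source w = e \<Longrightarrow> w \<cdot> Triv e = w"
  by (induction w) auto

lemma is_walk_comp [simp]:
  "\<lbrakk>is_walk E u; is_walk E w; source u = terminal w\<rbrakk> \<Longrightarrow> is_walk E (u \<cdot> w)"
  by (induction u) auto

lemma is_walk_ends [simp]:
  assumes "is_walk E w"
  shows "source w \<in> angles E" "terminal w \<in> angles E"
  using assms by (induction w) auto

lemma source_g_walk [simp]: "source (g_walk E k e) = e"
  by (induction k) auto

fun inv_step :: "step \<Rightarrow> step" where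
  "inv_step Act = ActInv"
| "inv_step ActInv = Act"
| "inv_step Tau = Tau"

primrec inv_walk :: "'a walk \<Rightarrow> 'a walk" where
  "inv_walk (Triv e) = Triv e"
| "inv_walk (Step e \<delta> w) = inv_walk w \<cdot> Step (terminal w) (inv_step \<delta>) (Triv e)"

lemma source_inv_walk [simp]: "source (inv_walk w) = terminal w"
  by (cases w) auto

lemma terminal_inv_walk [simp]: "terminal (inv_walk w) = source w"
  by (induction w) auto

lemma part_of_eq:
  assumes "partition_on A Q" "q \<in> Q" "e \<in> q"
  shows "part_of Q e = q"
  unfolding part_of_def
proof (rule the_equality)
  show "p = q" if "p \<in> Q \<and> e \<in> p" for p
    using that assms partition_onD2[OF assms(1)] by (auto simp: disjoint_def)
qed (use assms in auto)

lemma part_of_in: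
  assumes "partition_on A Q" "e \<in> A"
  shows "part_of Q e \<in> Q" "e \<in> part_of Q e"
proof -
  obtain q where "q \<in> Q" "e \<in> q" using assms partition_onD1 by blast
  with part_of_eq[OF assms(1)] show "part_of Q e \<in> Q" "e \<in> part_of Q e" by auto
qed

context fractional_brauer_configuration
begin

lemma act_closed [simp]: "e \<in> angles E \<Longrightarrow> act E k e \<in> angles E"
  using group_action.element_image[OF action, of k e] by simp

lemma act_add: "e \<in> angles E \<Longrightarrow> act E (i + j) e = act E i (act E j e)"
  using group_action.composition_rule[OF action, of e i j] by simp

lemma act_0 [simp]: "e \<in> angles E \<Longrightarrow> act E 0 e = e"
  using group_action.id_eq_one[OF action] by (metis one_integer_group restrict_apply')

lemma act_inverse [simp]:
  assumes "e \<in> angles E"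
  shows "act E 1 (act E (- 1) e) = e" "act E (- 1) (act E 1 e) = e"
  using assms by (simp_all flip: act_add)

lemma lpart_eq_imp_polygon_eq:
  assumes "e \<in> angles E" "h \<in> angles E" "lpart E e = lpart E h"
  shows "polygon E e = polygon E h"
proof -
  have "h \<in> polygon E e"
    using assms f1[of e] part_of_in(2)[OF partition_L, of h] by auto
  then show ?thesis
    using part_of_eq[OF partition_P] part_of_in(1)[OF partition_P] assms by metis
qed

lemma terminal_g_walk [simp]: "e \<in> angles E \<Longrightarrow> terminal (g_walk E k e) = act E (int k) e"
  by (induction k) auto

lemma is_walk_g_walk [simp]: "e \<in> angles E \<Longrightarrow> is_walk E (g_walk E k e)"
proof (induction k)
  case (Suc k)
  then show ?case by (simp flip: act_add)
qed simp

lemma g_walk_add: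
  "e \<in> angles E \<Longrightarrow> g_walk E (k + l) e = g_walk E k (act E (int l) e) \<cdot> g_walk E l e"
proof (induction k)
  case (Suc k)
  have "act E (1 + int k) (act E (int l) e) = act E (1 + (int k + int l)) e"
    using Suc.prems by (simp add: add.assoc flip: act_add)
  with Suc show ?case by simp
qed simp

lemma is_walk_inv_walk [simp]: "is_walk E w \<Longrightarrow> is_walk E (inv_walk w)"
proof (induction w)
  case (Step e \<delta> w)
  then have "is_step E (terminal w) (inv_step \<delta>) e" by (cases \<delta>) auto
  with Step show ?case by simp
qed simp

text \<open>The axioms make the two sides of each relation genuine walks: f4 allows the \<tau> step
  after the turns in h3, f2 the one in h4, and the inclusion of L-parts in polygons the \<tau> step
  before the turn in h4.\<close>

lemma homotopicD:
  assumes "homotopic E u w"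
  shows "is_walk E u" "is_walk E w" "source u = source w" "terminal u = terminal w"
proof -
  have "is_walk E u \<and> is_walk E w \<and> source u = source w \<and> terminal u = terminal w"
    using assms
  proof (induction rule: homotopic.induct)
    case (h3 e h)
    then show ?case using f4[of e h] by auto
  next
    case (h4 e h)
    then show ?case using f2[of e h] lpart_eq_imp_polygon_eq[of e h] by auto
  qed auto
  then show "is_walk E u" "is_walk E w" "source u = source w" "terminal u = terminal w" by auto
qed

lemma comp_cong:
  assumes "homotopic E u u'" "homotopic E w w'" "source u = terminal w"
  shows "homotopic E (u \<cdot> w) (u' \<cdot> w')"
proof -
  have "homotopic E (u \<cdot> w) (u' \<cdot> w)"
    using assms homotopicD[OF assms(1)] homotopicD[OF assms(2)] by (intro homotopic.h5_right) auto
  moreover have "homotopic E (u' \<cdot> w) (u' \<cdot> w')"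
    using assms homotopicD[OF assms(1)] homotopicD[OF assms(2)] by (intro homotopic.h5_left) auto
  ultimately show ?thesis by (rule homotopic.trans)
qed

lemma step_cancel:
  assumes "is_step E e \<delta> h" "e \<in> angles E" "h \<in> angles E"
  shows "homotopic E (Step h (inv_step \<delta>) (Step e \<delta> (Triv h))) (Triv h)"
proof (cases \<delta>)
  case Act
  then show ?thesis using assms homotopic.h1_left by auto
next
  case ActInv
  then show ?thesis using assms homotopic.h1_right by auto
next
  case Tau
  \<comment> \<open>h1 only removes \<tau> steps from an angle to itself; h2 first merges the step
    and its reverse into one of these.\<close>
  then have "homotopic E (tau_walk h e \<cdot> tau_walk e h) (tau_walk h h)"
    using assms by (intro homotopic.h2) auto
  then show ?thesis using Tau homotopic.h1_tau[OF assms(3)] by (auto intro: homotopic.trans)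
qed

lemma inv_step_inv_step [simp]: "inv_step (inv_step \<delta>) = \<delta>"
  by (cases \<delta>) auto

lemma is_step_inv_step:
  "\<lbrakk>is_step E e \<delta> h; e \<in> angles E; h \<in> angles E\<rbrakk> \<Longrightarrow> is_step E h (inv_step \<delta>) e"
  by (cases \<delta>) auto

lemma inv_walk_comp_self:
  "is_walk E w \<Longrightarrow> homotopic E (inv_walk w \<cdot> w) (Triv (source w))"
proof (induction w)
  case (Step e \<delta> w)
  let ?c = "Step (terminal w) (inv_step \<delta>) (Step e \<delta> (Triv (terminal w)))"
  have "homotopic E (inv_walk w \<cdot> (?c \<cdot> w)) (inv_walk w \<cdot> (Triv (terminal w) \<cdot> w))"
    using Step.prems is_step_inv_step[of e \<delta> "terminal w"]
    by (intro comp_cong homotopic.refl step_cancel) auto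
  then show ?case using Step by (auto intro: homotopic.trans)
qed (auto intro: homotopic.refl)

lemma comp_inv_walk_self:
  "is_walk E w \<Longrightarrow> homotopic E (w \<cdot> inv_walk w) (Triv (terminal w))"
proof (induction w)
  case (Step e \<delta> w)
  let ?s = "Step e \<delta> (Triv (terminal w))" and ?s' = "Step (terminal w) (inv_step \<delta>) (Triv e)"
  have st: "is_step E (terminal w) (inv_step \<delta>) e"
    using Step.prems by (intro is_step_inv_step) auto
  \<comment> \<open>Here the induction hypothesis empties the middle, and the two outer steps cancel
    last.\<close>
  have "homotopic E (?s \<cdot> ((w \<cdot> inv_walk w) \<cdot> ?s')) (?s \<cdot> (Triv (terminal w) \<cdot> ?s'))"
    using Step st by (intro comp_cong homotopic.refl) auto
  moreover have "homotopic E (?s \<cdot> (Triv (terminal w) \<cdot> ?s')) (Triv e)"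
    using step_cancel[OF st] Step.prems by simp
  ultimately show ?case by (auto intro: homotopic.trans)
qed (auto intro: homotopic.refl)

lemma inv_walk_cancel:
  assumes "is_walk E u" "is_walk E w" "terminal u = terminal w"
  shows "homotopic E (u \<cdot> (inv_walk u \<cdot> w)) w"
  using comp_cong[OF comp_inv_walk_self[OF assms(1)] homotopic.refl[OF assms(2)]] assms by simp

section \<open>The group of homotopy classes\<close>

abbreviation hclass :: "'a walk \<Rightarrow> 'a walk set" where
  "hclass w \<equiv> homotopy_rel E `` {w}"

lemma hclass_eqI:
  assumes "homotopic E u w"
  shows "hclass u = hclass w"
  using assms by (auto simp: homotopy_rel_def intro: homotopic.trans homotopic.sym)

lemma hclass_in_carrier:
  "\<lbrakk>is_walk E w; source w = b; terminal w = b\<rbrakk> \<Longrightarrow>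
    hclass w \<in> carrier (fundamental_group E b)"
  by (simp add: fundamental_group_def closed_walks_def quotientI)

lemma fundamental_group_carrierE:
  assumes "x \<in> carrier (fundamental_group E b)"
  obtains w where "is_walk E w" "source w = b" "terminal w = b" "x = hclass w"
  using assms by (auto simp: fundamental_group_def closed_walks_def elim!: quotientE)

lemma one_fundamental_group: "\<one>\<^bsub>fundamental_group E b\<^esub> = hclass (Triv b)"
  by (simp add: fundamental_group_def)

text \<open>The multiplication does not depend on the base point, so the formula also covers
  composable walks that are not closed.\<close>

lemma hclass_mult:
  assumes "is_walk E u" "is_walk E w" "source u = terminal w"
  shows "hclass u \<otimes>\<^bsub>fundamental_group E b\<^esub> hclass w = hclass (u \<cdot> w)"
proof -
  have "(\<Union>u'\<in>hclass u. \<Union>w'\<in>hclass w. hclass (u' \<cdot> w')) =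
      (\<Union>u'\<in>hclass u. \<Union>w'\<in>hclass w. hclass (u \<cdot> w))"
  proof (intro SUP_cong HOL.refl)
    fix u' w' assume "u' \<in> hclass u" "w' \<in> hclass w"
    then have "homotopic E (u \<cdot> w) (u' \<cdot> w')"
      using assms by (intro comp_cong) (auto simp: homotopy_rel_def)
    then show "hclass (u' \<cdot> w') = hclass (u \<cdot> w)" by (simp add: hclass_eqI)
  qed
  moreover have "u \<in> hclass u" "w \<in> hclass w"
    using assms by (auto simp: homotopy_rel_def intro: homotopic.refl)
  ultimately show ?thesis unfolding fundamental_group_def by auto
qed

lemma group_fundamental_group:
  assumes "b \<in> angles E"
  shows "group (fundamental_group E b)"
proof (rule groupI)
  fix x assume "x \<in> carrier (fundamental_group E b)"
  then obtain w where w: "is_walk E w" "source w = b" "terminal w = b" "x = hclass w"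
    by (rule fundamental_group_carrierE)
  then have "hclass (inv_walk w) \<otimes>\<^bsub>fundamental_group E b\<^esub> x = \<one>\<^bsub>fundamental_group E b\<^esub>"
    using hclass_eqI[OF inv_walk_comp_self[OF w(1)]]
    by (simp add: hclass_mult one_fundamental_group)
  then show "\<exists>y\<in>carrier (fundamental_group E b).
      y \<otimes>\<^bsub>fundamental_group E b\<^esub> x = \<one>\<^bsub>fundamental_group E b\<^esub>"
    using w by (intro bexI[of _ "hclass (inv_walk w)"] hclass_in_carrier) auto
qed (auto elim!: fundamental_group_carrierE
    simp: hclass_mult one_fundamental_group hclass_in_carrier assms)

end

section \<open>Transport of walks to the base point\<close>

locale path_system = fractional_brauer_configuration +
  fixes b :: 'a and q :: "'a \<Rightarrow> 'a walk"
  assumes base: "b \<in> angles E"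
    and q: "\<And>e. e \<in> angles E \<Longrightarrow> is_walk E (q e)"
    and source_q: "\<And>e. e \<in> angles E \<Longrightarrow> source (q e) = b"
    and terminal_q: "\<And>e. e \<in> angles E \<Longrightarrow> terminal (q e) = e"
begin

abbreviation "\<G> \<equiv> fundamental_group E b"

sublocale \<G>: group \<G>
  by (rule group_fundamental_group[OF base])

text \<open>The retraction of the fundamental groupoid onto its group at \<open>b\<close>. Being
  defined on open walks, it can be computed step by step.\<close>

definition transport :: "'a walk \<Rightarrow> 'a walk set" where
  "transport w = hclass (inv_walk (q (terminal w)) \<cdot> (w \<cdot> q (source w)))"

lemma transport_closed [simp]: "is_walk E w \<Longrightarrow> transport w \<in> carrier \<G>"
  unfolding transport_def by (intro hclass_in_carrier) (auto simp: q source_q terminal_q)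

lemma transport_homotopic: "homotopic E u w \<Longrightarrow> transport u = transport w"
  unfolding transport_def using homotopicD[of u w]
  by (intro hclass_eqI) (auto intro!: comp_cong homotopic.refl simp: q source_q terminal_q)

lemma transport_comp:
  assumes "is_walk E u" "is_walk E w" "source u = terminal w"
  shows "transport (u \<cdot> w) = transport u \<otimes>\<^bsub>\<G>\<^esub> transport w"
proof -
  let ?t = "terminal w"
  \<comment> \<open>The detour from the middle angle to \<open>b\<close> and back is inserted
    between the two walks.\<close>
  have "homotopic E (q ?t \<cdot> (inv_walk (q ?t) \<cdot> (w \<cdot> q (source w)))) (w \<cdot> q (source w))"
    using assms by (intro inv_walk_cancel) (auto simp: q source_q terminal_q)
  then have "homotopic E
      (inv_walk (q (terminal u)) \<cdot> (u \<cdot> (q ?t \<cdot> (inv_walk (q ?t) \<cdot> (w \<cdot> q (source w))))))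
      (inv_walk (q (terminal u)) \<cdot> (u \<cdot> (w \<cdot> q (source w))))"
    using assms
    by (intro comp_cong[OF homotopic.refl comp_cong[OF homotopic.refl]])
      (auto simp: q source_q terminal_q)
  then show ?thesis
    unfolding transport_def using assms
    by (subst hclass_mult) (auto simp: q source_q terminal_q intro!: hclass_eqI intro: homotopic.sym)
qed

lemma transport_Triv [simp]: "e \<in> angles E \<Longrightarrow> transport (Triv e) = \<one>\<^bsub>\<G>\<^esub>"
  unfolding transport_def one_fundamental_group
  using inv_walk_comp_self[OF q] by (auto simp: source_q intro!: hclass_eqI)

lemma transport_inv_walk:
  assumes "is_walk E w"
  shows "transport (inv_walk w) = inv\<^bsub>\<G>\<^esub> transport w"
proof -
  have "transport (inv_walk w) \<otimes>\<^bsub>\<G>\<^esub> transport w = \<one>\<^bsub>\<G>\<^esub>"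
    using assms transport_homotopic[OF inv_walk_comp_self[OF assms]]
    by (simp flip: transport_comp)
  then show ?thesis using assms by (simp add: \<G>.inv_equality)
qed

end

section \<open>Vertices of a Brauer configuration\<close>

context brauer_configuration
begin

definition vertex_of :: "'a \<Rightarrow> 'a set" where
  "vertex_of e = orbit integer_group (act E) e"

definition vertex_base :: "'a set \<Rightarrow> 'a" where
  "vertex_base v = (SOME e. e \<in> v)"

definition polygon_base :: "'a set \<Rightarrow> 'a" where
  "polygon_base p = (SOME e. e \<in> p)"

text \<open>Identifies the orbit with the residues modulo its size, with \<open>g\<close> acting as
  +1; see \<open>position_act\<close>.\<close>

definition position :: "'a \<Rightarrow> nat" where
  "position e = (LEAST j. act E (int j) (vertex_base (vertex_of e)) = e)"

text \<open>The f-degree as a natural number; the division is exact by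
  \<open>dval_eq\<close>.\<close>

definition vertex_degree :: "'a set \<Rightarrow> nat" where
  "vertex_degree v = the_elem (dval E ` v) div card v"

lemma vertex_of_eq: "vertex_of e = range (\<lambda>k. act E k e)"
  by (auto simp: vertex_of_def orbit_def)

lemma vertices_eq: "vertices E = vertex_of ` angles E"
  by (auto simp: vertices_def orbits_def vertex_of_def)

lemma self_in_vertex_of: "e \<in> angles E \<Longrightarrow> e \<in> vertex_of e"
  unfolding vertex_of_eq using act_0 by (metis rangeI)

lemma vertex_of_subset: "e \<in> angles E \<Longrightarrow> vertex_of e \<subseteq> angles E"
  by (auto simp: vertex_of_eq)

lemma vertex_of_act [simp]:
  assumes "e \<in> angles E"
  shows "vertex_of (act E k e) = vertex_of e"
proof -
  have "act E j e = act E (j - k) (act E k e)" for j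
    using act_add[OF assms, of "j - k" k] by simp
  moreover have "act E j (act E k e) = act E (j + k) e" for j
    using act_add[OF assms, of j k] by simp
  ultimately show ?thesis
    unfolding vertex_of_eq by (metis (no_types, lifting) image_subset_iff rangeI subset_antisym)
qed

lemma vertex_of_eq_if_mem:
  assumes "e \<in> angles E" "h \<in> vertex_of e"
  shows "vertex_of h = vertex_of e"
proof -
  obtain k where "h = act E k e" using assms(2) by (auto simp: vertex_of_eq)
  then show ?thesis using assms(1) by simp
qed

lemma finite_vertex: "e \<in> angles E \<Longrightarrow> finite (vertex_of e)"
  using vertex_of_subset finite_angles finite_subset by blast

lemma card_vertex_pos: "e \<in> angles E \<Longrightarrow> 0 < card (vertex_of e)"
  using self_in_vertex_of finite_vertex card_gt_0_iff by blast

lemma act_diff_eq_iff: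
  assumes "e \<in> angles E"
  shows "act E i e = act E j e \<longleftrightarrow> act E (i - j) e = e"
proof
  assume "act E i e = act E j e"
  then have "act E (- j) (act E i e) = act E (- j) (act E j e)" by simp
  then show "act E (i - j) e = e"
    using act_add[OF assms, of "- j" i] act_add[OF assms, of "- j" j] assms by simp
next
  assume "act E (i - j) e = e"
  then have "act E j (act E (i - j) e) = act E j e" by simp
  then show "act E i e = act E j e" using act_add[OF assms, of j "i - j"] by simp
qed

lemma act_mult_period:
  assumes "e \<in> angles E" "act E m e = e"
  shows "act E (m * t) e = e"
proof -
  have nat: "act E (m * int k) e = e" for k
  proof (induction k)
    case (Suc k)
    have "act E (m * int (Suc k)) e = act E (m * int k) (act E m e)"
      using act_add[OF assms(1), of "m * int k" m] by (simp add: algebra_simps)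
    then show ?case using assms Suc by simp
  qed (use assms in simp)
  show ?thesis
  proof (cases "t \<ge> 0")
    case True
    then show ?thesis using nat[of "nat t"] by simp
  next
    case False
    then have "act E (0 - m * t) e = e" using nat[of "nat (- t)"] by simp
    then show ?thesis using act_diff_eq_iff[OF assms(1), of 0 "m * t"] assms(1) by simp
  qed
qed

text \<open>Orbit and stabiliser: the least positive period \<open>m\<close> divides every period,
  and the first \<open>m\<close> translates of \<open>e\<close> are distinct and exhaust the
  orbit.\<close>

lemma act_eq_self_iff:
  assumes e: "e \<in> angles E"
  shows "act E k e = e \<longleftrightarrow> int (card (vertex_of e)) dvd k"
proof -
  \<comment> \<open>Pigeonhole: a finite orbit forces two translates to coincide.\<close>
  have "\<not> inj (\<lambda>j::nat. act E (int j) e)"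
    using finite_vertex[OF e] finite_subset[of "range (\<lambda>j. act E (int j) e)" "vertex_of e"]
    by (auto simp: vertex_of_eq dest: finite_imageD)
  then obtain i j :: nat where "i < j" "act E (int j) e = act E (int i) e"
    unfolding inj_def by (metis linorder_neqE_nat)
  then have "0 < j - i \<and> act E (int (j - i)) e = e"
    using act_diff_eq_iff[OF e, of "int j" "int i"] by (simp add: of_nat_diff)
  then have ex: "\<exists>m. 0 < m \<and> act E (int m) e = e" by blast
  define m where "m = (LEAST m. 0 < m \<and> act E (int m) e = e)"
  have m: "0 < m" "act E (int m) e = e" unfolding m_def using LeastI_ex[OF ex] by auto
  have least: "m \<le> l" if "0 < l" "act E (int l) e = e" for l
    unfolding m_def using that by (intro Least_le) auto
  have "act E k e = act E (int (nat (k mod int m))) e" for k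
  proof -
    have "k - k mod int m = int m * (k div int m)" by (simp add: minus_mod_eq_mult_div)
    then have "act E (k - k mod int m) e = e" using act_mult_period[OF e m(2)] by simp
    then show ?thesis using act_diff_eq_iff[OF e, of k "k mod int m"] m(1) by simp
  qed
  moreover have "nat (k mod int m) < m" for k using m(1) by (simp add: nat_less_iff)
  ultimately have orbit: "vertex_of e = (\<lambda>j. act E (int j) e) ` {..<m}"
    unfolding vertex_of_eq by blast
  have "inj_on (\<lambda>j. act E (int j) e) {..<m}"
  proof (rule linorder_inj_onI)
    fix i j assume ij: "i < j" "i \<in> {..<m}" "j \<in> {..<m}"
    show "act E (int i) e \<noteq> act E (int j) e"
    proof
      assume "act E (int i) e = act E (int j) e"
      then have "act E (int (j - i)) e = e"
        using act_diff_eq_iff[OF e, of "int j" "int i"] ij by (simp add: of_nat_diff)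
      then show False using least[of "j - i"] ij by auto
    qed
  qed auto
  then have card: "card (vertex_of e) = m" unfolding orbit by (simp add: card_image)
  show ?thesis
  proof
    assume ke: "act E k e = e"
    have "k - k mod int m = int m * (k div int m)" by (simp add: minus_mod_eq_mult_div)
    then have "act E (k - k mod int m) e = e" using act_mult_period[OF e m(2)] by simp
    \<comment> \<open>The remainder is again a period, but below the least positive one.\<close>
    then have "act E (int (nat (k mod int m))) e = e"
      using act_diff_eq_iff[OF e, of k "k mod int m"] m(1) ke by simp
    moreover have "nat (k mod int m) < m" using m(1) by (simp add: nat_less_iff)
    ultimately have "\<not> 0 < nat (k mod int m)" using least[of "nat (k mod int m)"] by linarith
    moreover have "0 \<le> k mod int m" using m(1) by simp
    ultimately have "k mod int m = 0" by linarith
    then show "int (card (vertex_of e)) dvd k" unfolding card by (rule mod_0_imp_dvd)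
  next
    assume "int (card (vertex_of e)) dvd k"
    then show "act E k e = e" unfolding card using act_mult_period[OF e m(2)] by (auto elim: dvdE)
  qed
qed

lemma vertex_base_mem:
  assumes "e \<in> angles E"
  shows "vertex_base (vertex_of e) \<in> vertex_of e"
  unfolding vertex_base_def using self_in_vertex_of[OF assms] by (rule someI)

lemma vertex_base_angle [simp]: "e \<in> angles E \<Longrightarrow> vertex_base (vertex_of e) \<in> angles E"
  using vertex_base_mem vertex_of_subset by blast

lemma vertex_of_vertex_base [simp]:
  "e \<in> angles E \<Longrightarrow> vertex_of (vertex_base (vertex_of e)) = vertex_of e"
  using vertex_of_eq_if_mem[OF _ vertex_base_mem] .

lemma position_eqI:
  assumes e: "e \<in> angles E" and j: "act E (int j) (vertex_base (vertex_of e)) = e"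
    and less: "j < card (vertex_of e)"
  shows "position e = j"
  unfolding position_def
proof (rule Least_equality)
  let ?b = "vertex_base (vertex_of e)"
  fix i assume "act E (int i) ?b = e"
  then have "int (card (vertex_of e)) dvd int j - int i"
    using act_diff_eq_iff[of ?b "int j" "int i"] act_eq_self_iff[of ?b] e j by simp
  then show "j \<le> i"
    using less zdvd_imp_le[of "int (card (vertex_of e))" "int j - int i"] by linarith
qed (use j in auto)

lemma position:
  assumes e: "e \<in> angles E"
  shows "position e < card (vertex_of e)"
    and "act E (int (position e)) (vertex_base (vertex_of e)) = e"
proof -
  let ?b = "vertex_base (vertex_of e)" and ?m = "card (vertex_of e)"
  have "e \<in> vertex_of ?b" using e self_in_vertex_of by simp
  then obtain k where k: "e = act E k ?b" by (auto simp: vertex_of_eq)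
  have "act E (k - k mod int ?m) ?b = ?b"
    using act_eq_self_iff[of ?b] e by (simp add: minus_mod_eq_mult_div)
  then have "act E (k mod int ?m) ?b = e"
    using k act_diff_eq_iff[of ?b k "k mod int ?m"] e by simp
  then have j: "act E (int (nat (k mod int ?m))) ?b = e" "nat (k mod int ?m) < ?m"
    using card_vertex_pos[OF e] by (auto simp: nat_less_iff)
  then have "position e = nat (k mod int ?m)" by (intro position_eqI e)
  then show "position e < ?m" "act E (int (position e)) ?b = e" using j by auto
qed

lemma position_act:
  assumes e: "e \<in> angles E"
  shows "position (act E (int k) e) = (position e + k) mod card (vertex_of e)"
proof (rule position_eqI)
  let ?b = "vertex_base (vertex_of e)" and ?m = "card (vertex_of e)"
  let ?j = "(position e + k) mod ?m"
  have "int ?m dvd int (position e + k) - int ?j"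
    by (simp add: zmod_int minus_mod_eq_mult_div del: of_nat_add)
  then have "act E (int ?j) ?b = act E (int (position e + k)) ?b"
    using act_diff_eq_iff[of ?b "int (position e + k)" "int ?j"] act_eq_self_iff[of ?b] e by simp
  also have "\<dots> = act E (int k) (act E (int (position e)) ?b)"
    using act_add[of ?b "int k" "int (position e)"] e by (simp add: add.commute)
  finally show "act E (int ?j) (vertex_base (vertex_of (act E (int k) e))) = act E (int k) e"
    using e position[OF e] by simp
  show "?j < card (vertex_of (act E (int k) e))" using e card_vertex_pos by simp
qed (use e in simp)

lemma position_vertex_base [simp]:
  "e \<in> angles E \<Longrightarrow> position (vertex_base (vertex_of e)) = 0"
  using card_vertex_pos by (intro position_eqI) auto

text \<open>An integral f-degree means that the size of the orbit divides \<open>dval E e\<close>,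
  so that \<open>dval E e\<close> turns make a whole number of rounds.\<close>

lemma f_degree_eq: "e \<in> angles E \<Longrightarrow> f_degree E (vertex_of e) = of_nat (vertex_degree (vertex_of e))"
  and dval_eq: "e \<in> angles E \<Longrightarrow> dval E e = vertex_degree (vertex_of e) * card (vertex_of e)"
proof -
  assume e: "e \<in> angles E"
  have v: "vertex_of e \<in> vertices E" using e by (simp add: vertices_eq)
  have "dval E h = dval E e" if "h \<in> vertex_of e" for h
    by (rule f3[OF v that self_in_vertex_of[OF e]])
  then have "dval E ` vertex_of e = (\<lambda>_. dval E e) ` vertex_of e" by (intro image_cong) auto
  then have "dval E ` vertex_of e = {dval E e}" using self_in_vertex_of[OF e] by auto
  then have D: "the_elem (dval E ` vertex_of e) = dval E e" by simp
  have pos: "card (vertex_of e) > 0" by (rule card_vertex_pos[OF e])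
  obtain z where "of_nat (dval E e) / of_nat (card (vertex_of e)) = (of_int z :: rat)"
    using f_degree_integer[OF v] by (auto simp: f_degree_def D elim: Ints_cases)
  then have "(of_nat (dval E e) :: rat) = of_int z * of_nat (card (vertex_of e))"
    using pos by (simp add: field_simps)
  then have "int (dval E e) = z * int (card (vertex_of e))"
    by (metis (no_types) of_int_eq_iff of_int_mult of_int_of_nat_eq)
  then have dvd: "card (vertex_of e) dvd dval E e"
    by (metis dvd_triv_right of_nat_dvd_iff)
  then show deg: "dval E e = vertex_degree (vertex_of e) * card (vertex_of e)"
    by (simp add: vertex_degree_def D)
  show "f_degree E (vertex_of e) = of_nat (vertex_degree (vertex_of e))"
    using pos unfolding f_degree_def D by (subst deg) simp
qed

lemma act_dval [simp]: "e \<in> angles E \<Longrightarrow> act E (int (dval E e)) e = e"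
  by (simp add: act_eq_self_iff dval_eq)

lemma polygon_in: "e \<in> angles E \<Longrightarrow> polygon E e \<in> polygons E"
  by (rule part_of_in[OF partition_P])

lemma polygon_base [simp]:
  assumes "p \<in> polygons E"
  shows "polygon_base p \<in> angles E" "polygon E (polygon_base p) = p"
proof -
  have "p \<noteq> {}" using assms partition_onD3[OF partition_P] by auto
  then have "polygon_base p \<in> p" unfolding polygon_base_def by (simp add: some_in_eq)
  then show "polygon_base p \<in> angles E" "polygon E (polygon_base p) = p"
    using assms partition_onD1[OF partition_P] part_of_eq[OF partition_P] by auto
qed

end

section \<open>Naturality of the full turns\<close>

locale brauer_path_system = brauer_configuration + path_system
begin

abbreviation full_turn :: "'a \<Rightarrow> 'a walk set" where
  "full_turn e \<equiv> transport (g_walk E (dval E e) e)"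

lemma full_turn_closed [simp]: "e \<in> angles E \<Longrightarrow> full_turn e \<in> carrier \<G>"
  by simp

text \<open>Both sides come from the walk of \<open>dval E e + 1\<close> turns from
  \<open>e\<close>, cut after its first or before its last turn.\<close>

lemma full_turn_Act:
  assumes "e \<in> angles E"
  shows "full_turn (act E 1 e) \<otimes>\<^bsub>\<G>\<^esub> transport (g_walk E 1 e) =
    transport (g_walk E 1 e) \<otimes>\<^bsub>\<G>\<^esub> full_turn e"
proof -
  have "dval E (act E 1 e) = dval E e" using assms by (simp add: dval_eq)
  then have "g_walk E (dval E (act E 1 e)) (act E 1 e) \<cdot> g_walk E 1 e =
      g_walk E 1 e \<cdot> g_walk E (dval E e) e"
    using assms g_walk_add[of e "dval E e" 1] g_walk_add[of e 1 "dval E e"] by simp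
  then show ?thesis using assms by (simp del: One_nat_def g_walk.simps flip: transport_comp)
qed

text \<open>Naturality composes, so single steps suffice. For \<tau> it is h3, whose end angles are
  the starting ones again by \<open>act_dval\<close>.\<close>

lemma full_turn_natural:
  assumes "is_walk E w"
  shows "full_turn (terminal w) \<otimes>\<^bsub>\<G>\<^esub> transport w =
    transport w \<otimes>\<^bsub>\<G>\<^esub> full_turn (source w)"
  using assms
proof (induction w)
  case (Triv e)
  then show ?case by simp
next
  case (Step e \<delta> w)
  let ?t = "terminal w" and ?s = "Step e \<delta> (Triv (terminal w))"
  have w: "is_walk E w" "e \<in> angles E" "?t \<in> angles E" "is_walk E ?s" using Step.prems by auto
  have "full_turn e \<otimes>\<^bsub>\<G>\<^esub> transport ?s = transport ?s \<otimes>\<^bsub>\<G>\<^esub> full_turn ?t"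
  proof (cases \<delta>)
    case Act
    then show ?thesis using full_turn_Act[OF w(3)] Step.prems w by simp
  next
    case Tau
    then have "homotopic E (tau_walk e ?t \<cdot> g_walk E (dval E ?t) ?t) (g_walk E (dval E e) e \<cdot> tau_walk e ?t)"
      using homotopic.h3[of ?t E e] w Step.prems by simp
    from transport_homotopic[OF this] show ?thesis
      using Tau w by (simp flip: transport_comp)
  next
    case ActInv
    then have t: "?t = act E 1 e" using Step.prems by simp
    have s: "transport ?s = inv\<^bsub>\<G>\<^esub> transport (g_walk E 1 e)"
      using ActInv w by (simp add: t flip: transport_inv_walk)
    have c: "transport (g_walk E 1 e) \<in> carrier \<G>" using w by (intro transport_closed) simp
    \<comment> \<open>Naturality along the forward turn, solved for \<open>full_turn ?t\<close>,
      gives naturality along its inverse.\<close>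
    have "full_turn ?t = transport (g_walk E 1 e) \<otimes>\<^bsub>\<G>\<^esub> full_turn e \<otimes>\<^bsub>\<G>\<^esub> inv\<^bsub>\<G>\<^esub> transport (g_walk E 1 e)"
      using full_turn_Act[OF w(2)] w(2) c t by (metis \<G>.inv_solve_right full_turn_closed act_closed \<G>.m_closed)
    then show ?thesis
      unfolding s using c w(2) by (simp add: \<G>.m_assoc[symmetric] del: g_walk.simps One_nat_def)
  qed
  then have "full_turn e \<otimes>\<^bsub>\<G>\<^esub> (transport ?s \<otimes>\<^bsub>\<G>\<^esub> transport w) =
      (transport ?s \<otimes>\<^bsub>\<G>\<^esub> transport w) \<otimes>\<^bsub>\<G>\<^esub> full_turn (source w)"
    using Step.IH w by (metis \<G>.m_assoc full_turn_closed is_walk_ends(1) transport_closed)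
  moreover have "transport (Step e \<delta> w) = transport ?s \<otimes>\<^bsub>\<G>\<^esub> transport w"
    using transport_comp[of ?s w] w by simp
  ultimately show ?case by simp
qed

end

section \<open>Spanning trees of the incidence graph\<close>

locale pointed_brauer_configuration = brauer_configuration +
  fixes b :: 'a
  assumes base_angle: "b \<in> angles E"
begin

text \<open>The walk chosen for a vertex or polygon ends at its base angle; turns, respectively one
  \<tau> step in \<open>polygon_path\<close>, continue it to \<open>e\<close>. The generators b_j
  compare these two continuations.\<close>

definition vertex_path :: "('a set \<Rightarrow> 'a walk) \<Rightarrow> 'a \<Rightarrow> 'a walk" where
  "vertex_path p e = g_walk E (position e) (vertex_base (vertex_of e)) \<cdot> p (vertex_of e)"

definition polygon_path :: "('a set \<Rightarrow> 'a walk) \<Rightarrow> 'a \<Rightarrow> 'a walk" where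
  "polygon_path s e = tau_walk e (polygon_base (polygon E e)) \<cdot> s (polygon E e)"

text \<open>
  The angles are the edges of a bipartite graph on vertices and polygons.  In
  \<open>partial_tree V P T p s\<close> the angles in \<open>T\<close> form a tree spanning \<open>V\<close> and \<open>P\<close>, and
  \<open>p\<close> and \<open>s\<close> are walks inside this tree from \<open>b\<close> to the chosen angles of vertices and polygons.
\<close>

inductive partial_tree :: "'a set set \<Rightarrow> 'a set set \<Rightarrow> 'a set \<Rightarrow>
    ('a set \<Rightarrow> 'a walk) \<Rightarrow> ('a set \<Rightarrow> 'a walk) \<Rightarrow> bool" where
  start: "partial_tree {vertex_of b} {} {}
    (\<lambda>v. inv_walk (g_walk E (position b) (vertex_base (vertex_of b)))) s"
| add_polygon: "\<lbrakk>partial_tree V P T p s; e \<in> angles E; vertex_of e \<in> V; polygon E e \<notin> P\<rbrakk> \<Longrightarrow>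
    partial_tree V (insert (polygon E e) P) (insert e T) p
      (s(polygon E e := inv_walk (tau_walk e (polygon_base (polygon E e))) \<cdot> vertex_path p e))"
| add_vertex: "\<lbrakk>partial_tree V P T p s; e \<in> angles E; vertex_of e \<notin> V; polygon E e \<in> P\<rbrakk> \<Longrightarrow>
    partial_tree (insert (vertex_of e) V) P (insert e T)
      (p(vertex_of e :=
        inv_walk (g_walk E (position e) (vertex_base (vertex_of e))) \<cdot> polygon_path s e)) s"

definition walk_between :: "'a walk \<Rightarrow> 'a \<Rightarrow> 'a \<Rightarrow> bool" where
  "walk_between w e h \<longleftrightarrow> is_walk E w \<and> source w = e \<and> terminal w = h"

lemma vertex_path_walk:
  assumes "e \<in> angles E" "walk_between (p (vertex_of e)) b (vertex_base (vertex_of e))"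
  shows "walk_between (vertex_path p e) b e"
  using assms position(2) by (simp add: walk_between_def vertex_path_def)

lemma polygon_path_walk:
  assumes "e \<in> angles E" "walk_between (s (polygon E e)) b (polygon_base (polygon E e))"
  shows "walk_between (polygon_path s e) b e"
  using assms polygon_in[OF assms(1)] by (simp add: walk_between_def polygon_path_def)

lemma partial_tree_subset:
  assumes "partial_tree V P T p s"
  shows "V \<subseteq> vertices E" "P \<subseteq> polygons E" "T \<subseteq> angles E"
    "e \<in> T \<Longrightarrow> vertex_of e \<in> V \<and> polygon E e \<in> P" "vertex_of b \<in> V"
  using assms base_angle
  by (induction arbitrary: e rule: partial_tree.induct) (auto simp: vertices_eq polygon_in)

lemma finite_vertices: "finite (vertices E)"
  using finite_angles by (simp add: vertices_eq)

lemma finite_polygons: "finite (polygons E)"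
  by (rule finite_elements[OF finite_angles partition_P])

lemma partial_tree_finite:
  assumes "partial_tree V P T p s"
  shows "finite V" "finite P" "finite T"
  using partial_tree_subset[OF assms] finite_vertices finite_polygons finite_angles
  by (auto intro: finite_subset)

text \<open>The root is a node without an edge; each later stage adds one node and one edge, which
  is new because one of its ends is.\<close>

lemma partial_tree_card: "partial_tree V P T p s \<Longrightarrow> card T + 1 = card V + card P"
proof (induction rule: partial_tree.induct)
  case (add_polygon V P T p s e)
  then have "e \<notin> T" using partial_tree_subset(4) by blast
  then show ?case using add_polygon partial_tree_finite[OF add_polygon(1)] by simp
next
  case (add_vertex V P T p s e)
  then have "e \<notin> T" using partial_tree_subset(4) by blast
  then show ?case using add_vertex partial_tree_finite[OF add_vertex(1)] by simp
qed simp

lemma partial_tree_walk: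
  assumes "partial_tree V P T p s"
  shows "v \<in> V \<Longrightarrow> walk_between (p v) b (vertex_base v)"
    and "c \<in> P \<Longrightarrow> walk_between (s c) b (polygon_base c)"
  using assms
proof (induction arbitrary: v c rule: partial_tree.induct)
  case (start s)
  case 1
  then show ?case using base_angle position[OF base_angle] by (simp add: walk_between_def)
next
  case (start s)
  case 2
  then show ?case by simp
next
  case (add_polygon V P T p s e)
  case 1
  then show ?case using add_polygon by simp
next
  case (add_polygon V P T p s e)
  case 2
  have "walk_between (vertex_path p e) b e" using add_polygon by (intro vertex_path_walk) auto
  then have "walk_between (inv_walk (tau_walk e (polygon_base (polygon E e))) \<cdot> vertex_path p e) b
      (polygon_base (polygon E e))"
    using add_polygon(2) polygon_in by (simp add: walk_between_def)
  then show ?case using add_polygon 2 by (cases "c = polygon E e") auto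
next
  case (add_vertex V P T p s e)
  case 1
  have "walk_between (polygon_path s e) b e" using add_vertex by (intro polygon_path_walk) auto
  then have "walk_between (inv_walk (g_walk E (position e) (vertex_base (vertex_of e))) \<cdot> polygon_path s e)
      b (vertex_base (vertex_of e))"
    using add_vertex(2) position(2) by (simp add: walk_between_def)
  then show ?case using add_vertex 1 by (cases "v = vertex_of e") auto
next
  case (add_vertex V P T p s e)
  case 2
  then show ?case using add_vertex by simp
qed

lemma partial_tree_vertex_path:
  "\<lbrakk>partial_tree V P T p s; e \<in> angles E; vertex_of e \<in> V\<rbrakk> \<Longrightarrow> walk_between (vertex_path p e) b e"
  using partial_tree_walk(1) vertex_path_walk by blast

lemma partial_tree_polygon_path:
  "\<lbrakk>partial_tree V P T p s; e \<in> angles E; polygon E e \<in> P\<rbrakk> \<Longrightarrow> walk_between (polygon_path s e) b e"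
  using partial_tree_walk(2) polygon_path_walk by blast

text \<open>The walk to a new node runs through the new angle and on to the base angle, so
  continuing it back to that angle cancels. At older angles neither path changes, since both of
  their ends were already in the tree.\<close>

lemma partial_tree_paths_homotopic:
  assumes "partial_tree V P T p s" "e \<in> T"
  shows "homotopic E (vertex_path p e) (polygon_path s e)"
  using assms
proof (induction rule: partial_tree.induct)
  case (add_polygon V P T p s h)
  let ?s = "s(polygon E h := inv_walk (tau_walk h (polygon_base (polygon E h))) \<cdot> vertex_path p h)"
  show ?case
  proof (cases "e = h")
    case True
    have "walk_between (vertex_path p h) b h"
      using add_polygon by (intro partial_tree_vertex_path)
    then have "homotopic E (tau_walk h (polygon_base (polygon E h)) \<cdot>
        (inv_walk (tau_walk h (polygon_base (polygon E h))) \<cdot> vertex_path p h)) (vertex_path p h)"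
      using add_polygon(2) polygon_in by (intro inv_walk_cancel) (auto simp: walk_between_def)
    then show ?thesis
      using True by (simp add: polygon_path_def homotopic.sym)
  next
    case False
    then have "polygon E e \<noteq> polygon E h"
      using add_polygon partial_tree_subset(4)[OF add_polygon(1), of e] by auto
    then show ?thesis using add_polygon False by (simp add: polygon_path_def)
  qed
next
  case (add_vertex V P T p s h)
  show ?case
  proof (cases "e = h")
    case True
    have "walk_between (polygon_path s h) b h"
      using add_vertex by (intro partial_tree_polygon_path)
    then have "homotopic E (g_walk E (position h) (vertex_base (vertex_of h)) \<cdot>
        (inv_walk (g_walk E (position h) (vertex_base (vertex_of h))) \<cdot> polygon_path s h))
        (polygon_path s h)"
      using add_vertex(2) position(2) by (intro inv_walk_cancel) (auto simp: walk_between_def)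
    then show ?thesis
      using True by (simp add: vertex_path_def)
  next
    case False
    then have "vertex_of e \<noteq> vertex_of h"
      using add_vertex partial_tree_subset(4)[OF add_vertex(1), of e] by auto
    then show ?thesis using add_vertex False by (simp add: vertex_path_def)
  qed
qed simp

text \<open>The starting walk undoes the turns from the base angle to \<open>b\<close>, and its
  value at the vertex of \<open>b\<close> is never overwritten. Hence transport will not alter
  closed walks at \<open>b\<close>.\<close>

lemma partial_tree_vertex_path_base:
  "partial_tree V P T p s \<Longrightarrow> homotopic E (vertex_path p b) (Triv b)"
proof (induction rule: partial_tree.induct)
  case (start s)
  have "homotopic E (g_walk E (position b) (vertex_base (vertex_of b)) \<cdot>
      inv_walk (g_walk E (position b) (vertex_base (vertex_of b))))
      (Triv (terminal (g_walk E (position b) (vertex_base (vertex_of b)))))"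
    using base_angle by (intro comp_inv_walk_self) simp
  then show ?case using base_angle position(2)[OF base_angle] by (simp add: vertex_path_def)
next
  case (add_vertex V P T p s e)
  then have "vertex_of b \<noteq> vertex_of e" using partial_tree_subset(5)[OF add_vertex(1)] by auto
  then show ?case using add_vertex by (simp add: vertex_path_def)
qed

text \<open>Without such an angle, having its vertex in \<open>V\<close> would be invariant along
  walks: g steps keep the vertex and \<tau> steps the polygon. Connectedness would then put every
  node into the tree.\<close>

lemma partial_tree_extend:
  assumes conn: "connected_fbc E" and tree: "partial_tree V P T p s"
    and ne: "V \<noteq> vertices E \<or> P \<noteq> polygons E"
  obtains e where "e \<in> angles E" "vertex_of e \<in> V \<longleftrightarrow> polygon E e \<notin> P"
proof (rule ccontr)
  assume "\<not> thesis"
  then have eq: "vertex_of e \<in> V \<longleftrightarrow> polygon E e \<in> P" if "e \<in> angles E" for e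
    using that \<open>\<And>e. \<lbrakk>e \<in> angles E; (vertex_of e \<in> V) = (polygon E e \<notin> P)\<rbrakk> \<Longrightarrow> thesis\<close> by blast
  have "is_walk E w \<Longrightarrow> vertex_of (source w) \<in> V \<Longrightarrow> vertex_of (terminal w) \<in> V" for w
  proof (induction w)
    case (Step e \<delta> w)
    then show ?case using eq[of e] eq[of "terminal w"] by (cases \<delta>) auto
  qed simp
  moreover have "vertex_of b \<in> V" using partial_tree_subset(5)[OF tree] .
  ultimately have all: "vertex_of e \<in> V" if "e \<in> angles E" for e
    using conn that base_angle unfolding connected_fbc_def by metis
  have "vertices E \<subseteq> V" using all by (auto simp: vertices_eq)
  moreover have "polygons E \<subseteq> P"
    using all eq polygon_base by (metis subsetI)
  ultimately show False using ne partial_tree_subset[OF tree] by blast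
qed

text \<open>Trees grow one node at a time, so every number of nodes up to the total occurs; at the
  total nothing can be missing.\<close>

lemma partial_tree_of_card:
  assumes "connected_fbc E" "1 \<le> k" "k \<le> card (vertices E) + card (polygons E)"
  shows "\<exists>V P T p s. partial_tree V P T p s \<and> card V + card P = k"
  using assms(2,3)
proof (induction k rule: dec_induct)
  case base
  then show ?case using partial_tree.start by fastforce
next
  case (step k)
  then obtain V P T p s where tree: "partial_tree V P T p s" and k: "card V + card P = k" by auto
  then have "V \<noteq> vertices E \<or> P \<noteq> polygons E" using step by auto
  then obtain e where e: "e \<in> angles E" "vertex_of e \<in> V \<longleftrightarrow> polygon E e \<notin> P"
    using partial_tree_extend[OF assms(1) tree] by blast
  note fin = partial_tree_finite[OF tree]
  show ?case
  proof (cases "vertex_of e \<in> V")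
    case True
    with partial_tree.add_polygon[OF tree e(1)] e(2) k fin show ?thesis
      by (metis add_Suc_right card_insert_disjoint)
  next
    case False
    with partial_tree.add_vertex[OF tree e(1)] e(2) k fin show ?thesis
      by (metis add_Suc card_insert_disjoint)
  qed
qed

lemma spanning_tree_exists:
  assumes "connected_fbc E"
  obtains T p s where "partial_tree (vertices E) (polygons E) T p s"
proof -
  have "vertex_of b \<in> vertices E" using base_angle by (simp add: vertices_eq)
  then have "1 \<le> card (vertices E)" using finite_vertices by (metis One_nat_def Suc_leI card_gt_0_iff empty_iff)
  then obtain V P T p s where tree: "partial_tree V P T p s"
    and card: "card V + card P = card (vertices E) + card (polygons E)"
    using partial_tree_of_card[OF assms, of "card (vertices E) + card (polygons E)"] by auto
  have "card V \<le> card (vertices E)" "card P \<le> card (polygons E)"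
    using partial_tree_subset[OF tree] finite_vertices finite_polygons by (auto intro: card_mono)
  with card have "card V = card (vertices E)" "card P = card (polygons E)" by auto
  then have "V = vertices E" "P = polygons E"
    using partial_tree_subset[OF tree] finite_vertices finite_polygons by (simp_all add: card_subset_eq)
  with tree that show thesis by blast
qed

end

section \<open>Labelling walks by group elements\<close>

context brauer_configuration
begin

text \<open>The contribution of a round sits entirely on the step from the last angle back to the
  base angle, so turning from the base angle to any angle of its vertex has label one.\<close>

definition turn_label :: "('g, 'm) monoid_scheme \<Rightarrow> ('a set \<Rightarrow> 'g) \<Rightarrow> 'a \<Rightarrow> 'g" where
  "turn_label K a e = (if Suc (position e) = card (vertex_of e) then a (vertex_of e) else \<one>\<^bsub>K\<^esub>)"

text \<open>
  The angle \<open>e\<close> is an edge from its vertex to its polygon; crossing it contributes \<open>y e\<close>, and a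
  full round about a vertex \<open>v\<close> contributes \<open>a v\<close>.
\<close>

fun step_label :: "('g, 'm) monoid_scheme \<Rightarrow> ('a set \<Rightarrow> 'g) \<Rightarrow> ('a \<Rightarrow> 'g) \<Rightarrow> 'a \<Rightarrow> step \<Rightarrow> 'a \<Rightarrow> 'g" where
  "step_label K a y e Act h = turn_label K a h"
| "step_label K a y e ActInv h = inv\<^bsub>K\<^esub> turn_label K a e"
| "step_label K a y e Tau h = inv\<^bsub>K\<^esub> y e \<otimes>\<^bsub>K\<^esub> y h"

primrec walk_label :: "('g, 'm) monoid_scheme \<Rightarrow> ('a set \<Rightarrow> 'g) \<Rightarrow> ('a \<Rightarrow> 'g) \<Rightarrow> 'a walk \<Rightarrow> 'g" where
  "walk_label K a y (Triv e) = \<one>\<^bsub>K\<^esub>"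
| "walk_label K a y (Step e \<delta> w) = step_label K a y e \<delta> (terminal w) \<otimes>\<^bsub>K\<^esub> walk_label K a y w"

end

text \<open>The relations of the presentation, in an arbitrary group. As a power of each
  \<open>a v\<close>, \<open>z\<close> commutes with it, and together with \<open>z_commutes\<close>
  it commutes with every label.\<close>

locale labelling = brauer_configuration E + K: group K
  for E :: "'a fbc" and K :: "('g, 'm) monoid_scheme" (structure) +
  fixes a :: "'a set \<Rightarrow> 'g" and y :: "'a \<Rightarrow> 'g" and z :: 'g
  assumes a_closed: "v \<in> vertices E \<Longrightarrow> a v \<in> carrier K"
    and y_closed: "e \<in> angles E \<Longrightarrow> y e \<in> carrier K"
    and a_pow: "v \<in> vertices E \<Longrightarrow> a v [^] vertex_degree v = z"
    and z_commutes: "e \<in> angles E \<Longrightarrow> z \<otimes> y e = y e \<otimes> z"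
begin

abbreviation label :: "'a walk \<Rightarrow> 'g" where
  "label \<equiv> walk_label K a y"

lemma a_vertex_closed [simp]: "e \<in> angles E \<Longrightarrow> a (vertex_of e) \<in> carrier K"
  by (simp add: a_closed vertices_eq)

lemma turn_label_closed [simp]: "e \<in> angles E \<Longrightarrow> turn_label K a e \<in> carrier K"
  by (simp add: turn_label_def)

lemma step_label_closed [simp]:
  "\<lbrakk>e \<in> angles E; h \<in> angles E\<rbrakk> \<Longrightarrow> step_label K a y e \<delta> h \<in> carrier K"
  by (cases \<delta>) (auto simp: y_closed)

lemma label_closed [simp]: "is_walk E w \<Longrightarrow> label w \<in> carrier K"
  by (induction w) auto

lemma label_comp:
  "\<lbrakk>is_walk E u; is_walk E w; source u = terminal w\<rbrakk> \<Longrightarrow> label (u \<cdot> w) = label u \<otimes> label w"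
  by (induction u) (auto simp: K.m_assoc)

text \<open>The exponent counts how often \<open>k\<close> turns from \<open>e\<close> arrive at the
  base angle.\<close>

lemma label_g_walk:
  assumes e: "e \<in> angles E"
  shows "label (g_walk E k e) =
    a (vertex_of e) [^] ((position e + k) div card (vertex_of e))"
proof (induction k)
  case 0
  then show ?case using position(1)[OF e] by simp
next
  case (Suc k)
  let ?m = "card (vertex_of e)" and ?n = "position e + k" and ?a = "a (vertex_of e)"
  have "turn_label K a (act E (int k) e) =
      (if Suc (?n mod ?m) = ?m then ?a else \<one>)"
    using e by (simp add: turn_label_def position_act)
  \<comment> \<open>The quotient jumps exactly at remainder \<open>?m - 1\<close>, the position of
    the one step that carries \<open>?a\<close>.\<close>
  moreover have "Suc ?n div ?m = (if Suc (?n mod ?m) = ?m then Suc (?n div ?m) else ?n div ?m)"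
    by (simp add: div_Suc mod_Suc)
  ultimately show ?case
    using Suc e K.nat_pow_Suc2[of ?a] by simp
qed

lemma label_full_turn:
  assumes e: "e \<in> angles E"
  shows "label (g_walk E (dval E e) e) = z"
proof -
  have "(position e + dval E e) div card (vertex_of e) = vertex_degree (vertex_of e)"
    using position(1)[OF e] by (simp add: dval_eq[OF e])
  then show ?thesis
    using e a_pow by (simp add: label_g_walk vertices_eq)
qed

lemma z_closed: "e \<in> angles E \<Longrightarrow> z \<in> carrier K"
  using label_full_turn[of e] label_closed[of "g_walk E (dval E e) e"] by simp

text \<open>Labels of \<tau> steps telescope, which settles h1 and h2. In h3 both full turns have
  label \<open>z\<close>, which commutes with the label of the \<tau> step. In h4 the two angles
  coincide.\<close>

lemma label_homotopic: "homotopic E u w \<Longrightarrow> label u = label w"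
proof (induction rule: homotopic.induct)
  case (h3 e h)
  have c: "y e \<in> carrier K" "y h \<in> carrier K" "z \<in> carrier K"
    using h3 y_closed z_closed by auto
  have zh: "z \<otimes> inv (y h) = inv (y h) \<otimes> z"
    using z_commutes[OF h3(2)] c by (metis K.inv_solve_left K.inv_solve_right K.m_assoc K.inv_closed K.m_closed)
  have "label (tau_walk (act E (int (dval E h)) h) (act E (int (dval E e)) e) \<cdot> g_walk E (dval E e) e)
      = (inv (y h) \<otimes> y e) \<otimes> z"
    using h3 c label_full_turn by (simp add: label_comp)
  also have "\<dots> = z \<otimes> (inv (y h) \<otimes> y e)"
    using c z_commutes[OF h3(1)] zh by (metis K.inv_closed K.m_assoc)
  also have "\<dots> = label (g_walk E (dval E h) h \<cdot> tau_walk h e)"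
    using h3 c label_full_turn by (simp add: label_comp)
  finally show ?case .
next
  case (h4 e h)
  then have "h = e" using lpart_singleton by auto
  then show ?case using h4 y_closed by simp
next
  case (h2 e\<^sub>0 e\<^sub>1 e\<^sub>2)
  then have "y e\<^sub>0 \<in> carrier K" "y e\<^sub>1 \<in> carrier K" "y e\<^sub>2 \<in> carrier K" using y_closed by auto
  then have "y e\<^sub>1 \<otimes> (inv (y e\<^sub>1) \<otimes> y e\<^sub>0) = y e\<^sub>0" by (simp flip: K.m_assoc)
  then show ?case
    using \<open>y e\<^sub>0 \<in> carrier K\<close> \<open>y e\<^sub>1 \<in> carrier K\<close> \<open>y e\<^sub>2 \<in> carrier K\<close>
    by (simp add: K.m_assoc)
next
  case (h5_left u v w)
  then show ?case using homotopicD[OF h5_left(1)] by (simp add: label_comp)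
next
  case (h5_right u v w)
  then show ?case using homotopicD[OF h5_right(1)] by (simp add: label_comp)
qed (auto simp: y_closed)

lemma label_inv_walk:
  assumes "is_walk E w"
  shows "label (inv_walk w) = inv (label w)"
proof -
  have "label (inv_walk w) \<otimes> label w = \<one>"
    using label_homotopic[OF inv_walk_comp_self[OF assms]] assms by (simp add: label_comp)
  then show ?thesis using assms by (simp add: K.inv_equality)
qed

end

section \<open>Labels of the tree paths\<close>

locale pointed_labelling = labelling + pointed_brauer_configuration
begin

lemma label_return_walk [simp]:
  "e \<in> angles E \<Longrightarrow> label (g_walk E (position e) (vertex_base (vertex_of e))) = \<one>"
  using position(1) by (simp add: label_g_walk)

text \<open>Crossing an angle of \<open>T\<close> contributes one, so all that remains on the walk
  to a polygon is the last crossing, from the polygon back to its base angle.\<close>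

lemma partial_tree_label:
  assumes "partial_tree V P T p s" "\<And>e. e \<in> T \<Longrightarrow> y e = \<one>"
  shows "v \<in> V \<Longrightarrow> label (p v) = \<one>"
    and "c \<in> P \<Longrightarrow> label (s c) = inv (y (polygon_base c))"
  using assms
proof (induction arbitrary: v c rule: partial_tree.induct)
  case (start s)
  case 1
  then show ?case using base_angle by (simp add: label_inv_walk)
next
  case (start s)
  case 2
  then show ?case by simp
next
  case (add_polygon V P T p s e)
  case 1
  then show ?case using add_polygon by simp
next
  case (add_polygon V P T p s e)
  case 2
  have w: "walk_between (p (vertex_of e)) b (vertex_base (vertex_of e))"
    using partial_tree_walk(1) add_polygon by blast
  then have "label (vertex_path p e) = \<one>"
    using add_polygon 2 by (simp add: vertex_path_def label_comp walk_between_def)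
  moreover have "walk_between (vertex_path p e) b e" using vertex_path_walk[of e p] w add_polygon(2) by simp
  ultimately have "label (inv_walk (tau_walk e (polygon_base (polygon E e))) \<cdot> vertex_path p e)
      = inv (y (polygon_base (polygon E e)))"
    using add_polygon(2) 2 polygon_in by (simp add: walk_between_def label_comp y_closed)
  then show ?case using add_polygon 2 by (cases "c = polygon E e") auto
next
  case (add_vertex V P T p s e)
  case 1
  have w: "walk_between (s (polygon E e)) b (polygon_base (polygon E e))"
    using partial_tree_walk(2) add_vertex by blast
  then have "label (polygon_path s e) = \<one>"
    using add_vertex 1 polygon_in by (simp add: polygon_path_def label_comp walk_between_def y_closed)
  moreover have "walk_between (polygon_path s e) b e" using polygon_path_walk[of e s] w add_vertex(2) by simp
  ultimately have "label (inv_walk (g_walk E (position e) (vertex_base (vertex_of e))) \<cdot> polygon_path s e)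
      = \<one>"
    using add_vertex(2) position(2) by (simp add: walk_between_def label_comp label_inv_walk)
  then show ?case using add_vertex 1 by (cases "v = vertex_of e") auto
next
  case (add_vertex V P T p s e)
  case 2
  then show ?case using add_vertex by simp
qed

end

section \<open>Labellings and homomorphisms\<close>

lemma (in labelling) label_induces_hom:
  assumes "b \<in> angles E"
  obtains \<phi> where "\<phi> \<in> hom (fundamental_group E b) K"
    and "\<And>w. \<lbrakk>is_walk E w; source w = b; terminal w = b\<rbrakk> \<Longrightarrow> \<phi> (hclass w) = label w"
proof
  define \<phi> where "\<phi> X = label (SOME w. w \<in> X)" for X
  show \<phi>: "\<phi> (hclass w) = label w" if "is_walk E w" "source w = b" "terminal w = b" for w
  proof -
    have "w \<in> hclass w" using that by (auto simp: homotopy_rel_def intro: homotopic.refl)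
    then have "(SOME u. u \<in> hclass w) \<in> hclass w" by (rule someI)
    then show ?thesis
      unfolding \<phi>_def using label_homotopic by (auto simp: homotopy_rel_def)
  qed
  show "\<phi> \<in> hom (fundamental_group E b) K"
    by (rule homI) (auto elim!: fundamental_group_carrierE simp: \<phi> hclass_mult label_comp)
qed

text \<open>Labels are natural in the group; this will turn labels in the presented group into
  transports.\<close>

lemma (in brauer_configuration) hom_walk_label:
  assumes "group_hom H K \<psi>"
    and "\<And>v. v \<in> vertices E \<Longrightarrow> a v \<in> carrier H" "\<And>e. e \<in> angles E \<Longrightarrow> y e \<in> carrier H"
    and "\<And>v. v \<in> vertices E \<Longrightarrow> \<psi> (a v) = a' v" "\<And>e. e \<in> angles E \<Longrightarrow> \<psi> (y e) = y' e"
    and "is_walk E w"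
  shows "walk_label H a y w \<in> carrier H \<and> \<psi> (walk_label H a y w) = walk_label K a' y' w"
  using assms(6)
proof (induction w)
  case (Triv e)
  interpret \<psi>: group_hom H K \<psi> by fact
  show ?case by simp
next
  case (Step e \<delta> w)
  interpret \<psi>: group_hom H K \<psi> by fact
  have turn: "turn_label H a h \<in> carrier H \<and> \<psi> (turn_label H a h) = turn_label K a' h"
    if "h \<in> angles E" for h
    using that assms(2,4) by (simp add: turn_label_def vertices_eq)
  have "step_label H a y e \<delta> (terminal w) \<in> carrier H \<and>
      \<psi> (step_label H a y e \<delta> (terminal w)) = step_label K a' y' e \<delta> (terminal w)"
    using Step.prems turn assms(3,5) by (cases \<delta>) auto
  then show ?case using Step by simp
qed

section \<open>Transport along a spanning tree\<close>

locale spanned_brauer_configuration = pointed_brauer_configuration +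
  fixes T :: "'a set" and p s :: "'a set \<Rightarrow> 'a walk"
  assumes tree: "partial_tree (vertices E) (polygons E) T p s"
begin

lemma vertex_path_between: "e \<in> angles E \<Longrightarrow> walk_between (vertex_path p e) b e"
  by (rule partial_tree_vertex_path[OF tree]) (auto simp: vertices_eq)

lemma polygon_path_between: "e \<in> angles E \<Longrightarrow> walk_between (polygon_path s e) b e"
  by (rule partial_tree_polygon_path[OF tree]) (auto simp: polygon_in)

sublocale brauer_path_system E b "vertex_path p"
  using vertex_path_between base_angle by unfold_locales (auto simp: walk_between_def)

lemma transport_closed_walk:
  assumes "is_walk E w" "source w = b" "terminal w = b"
  shows "transport w = hclass w"
proof -
  let ?q = "vertex_path p b"
  note q = vertex_path_between[OF base_angle, unfolded walk_between_def]
  have "homotopic E (Triv b \<cdot> (inv_walk ?q \<cdot> (w \<cdot> ?q))) (?q \<cdot> (inv_walk ?q \<cdot> (w \<cdot> ?q)))"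
    using assms q partial_tree_vertex_path_base[OF tree]
    by (intro comp_cong) (auto intro: homotopic.refl homotopic.sym)
  moreover have "homotopic E (?q \<cdot> (inv_walk ?q \<cdot> (w \<cdot> ?q))) (w \<cdot> ?q)"
    using assms q by (intro inv_walk_cancel) auto
  moreover have "homotopic E (w \<cdot> ?q) (w \<cdot> Triv b)"
    using assms q partial_tree_vertex_path_base[OF tree]
    by (intro comp_cong) (auto intro: homotopic.refl)
  ultimately have "homotopic E (inv_walk ?q \<cdot> (w \<cdot> ?q)) w"
    using assms by (auto intro: homotopic.trans)
  then show ?thesis unfolding transport_def using assms by (simp add: hclass_eqI)
qed

lemma transport_vertex_path [simp]:
  assumes "e \<in> angles E"
  shows "transport (vertex_path p e) = \<one>\<^bsub>\<G>\<^esub>"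
proof -
  note q = vertex_path_between[OF assms, unfolded walk_between_def]
  have "homotopic E (inv_walk (vertex_path p e) \<cdot> vertex_path p e \<cdot> vertex_path p b)
      ((inv_walk (vertex_path p e) \<cdot> vertex_path p e) \<cdot> Triv b)"
    unfolding comp_walk_assoc[symmetric]
    using q partial_tree_vertex_path_base[OF tree] vertex_path_between[OF base_angle, unfolded walk_between_def]
    by (intro comp_cong homotopic.refl) auto
  moreover have "homotopic E ((inv_walk (vertex_path p e) \<cdot> vertex_path p e) \<cdot> Triv b) (Triv b)"
    using inv_walk_comp_self[of "vertex_path p e"] q by simp
  ultimately show ?thesis
    unfolding transport_def one_fundamental_group
    using q hclass_eqI[OF homotopic.trans] by simp
qed

text \<open>Naturality along the tree path to \<open>e\<close>, whose transport is one. This common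
  element is what all the powers a_i^d_i become.\<close>

lemma full_turn_eq:
  assumes "e \<in> angles E"
  shows "full_turn e = full_turn b"
  using full_turn_natural[of "vertex_path p e"] vertex_path_between[OF assms, unfolded walk_between_def]
    assms base_angle by simp

lemma full_turn_central:
  assumes "x \<in> carrier \<G>"
  shows "full_turn b \<otimes>\<^bsub>\<G>\<^esub> x = x \<otimes>\<^bsub>\<G>\<^esub> full_turn b"
proof -
  obtain w where w: "is_walk E w" "source w = b" "terminal w = b" "x = hclass w"
    using assms by (rule fundamental_group_carrierE)
  then show ?thesis using full_turn_natural[OF w(1)] transport_closed_walk[OF w(1-3)] by simp
qed

definition vertex_loop :: "'a set \<Rightarrow> 'a walk set" where
  "vertex_loop v = transport (g_walk E (card v) (vertex_base v))"

text \<open>Up to the null-homotopic path at \<open>b\<close>, the loop that reaches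
  \<open>e\<close> through its vertex and returns through its polygon.\<close>

definition edge_loop :: "'a \<Rightarrow> 'a walk set" where
  "edge_loop e = inv\<^bsub>\<G>\<^esub> transport (polygon_path s e)"

lemma vertex_loop_closed: "v \<in> vertices E \<Longrightarrow> vertex_loop v \<in> carrier \<G>"
  by (auto simp: vertex_loop_def vertices_eq)

lemma edge_loop_closed: "e \<in> angles E \<Longrightarrow> edge_loop e \<in> carrier \<G>"
  using polygon_path_between by (simp add: edge_loop_def walk_between_def)

text \<open>Each round of \<open>card v\<close> turns closes up, and a full turn is
  \<open>vertex_degree v\<close> rounds by \<open>dval_eq\<close>.\<close>

lemma vertex_loop_pow:
  assumes "v \<in> vertices E"
  shows "vertex_loop v [^]\<^bsub>\<G>\<^esub> vertex_degree v = full_turn b"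
proof -
  obtain e where e: "e \<in> angles E" "v = vertex_of e" using assms by (auto simp: vertices_eq)
  let ?h = "vertex_base v"
  have h: "?h \<in> angles E" "vertex_of ?h = v" using e by auto
  have per: "act E (int (card v)) ?h = ?h" using h act_eq_self_iff[of ?h] by simp
  have "vertex_loop v [^]\<^bsub>\<G>\<^esub> k = transport (g_walk E (k * card v) ?h)" for k :: nat
  proof (induction k)
    case (Suc k)
    have "g_walk E (k * card v + card v) ?h = g_walk E (k * card v) ?h \<cdot> g_walk E (card v) ?h"
      using g_walk_add[OF h(1), of "k * card v" "card v"] per by simp
    then show ?case using Suc h per
      by (simp add: vertex_loop_def transport_comp add.commute)
  qed (use h in simp)
  then have "vertex_loop v [^]\<^bsub>\<G>\<^esub> vertex_degree v = full_turn ?h"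
    using dval_eq[OF h(1)] h(2) by simp
  then show ?thesis using full_turn_eq[OF h(1)] by simp
qed

lemma edge_loop_tree:
  assumes "e \<in> T"
  shows "edge_loop e = \<one>\<^bsub>\<G>\<^esub>"
proof -
  have "e \<in> angles E" using assms partial_tree_subset(3)[OF tree] by auto
  then have "transport (polygon_path s e) = \<one>\<^bsub>\<G>\<^esub>"
    using transport_homotopic[OF partial_tree_paths_homotopic[OF tree assms]] by simp
  then show ?thesis by (simp add: edge_loop_def)
qed

lemma transport_g_walk_position:
  assumes e: "e \<in> angles E"
  shows "transport (g_walk E (position e) (vertex_base (vertex_of e))) = \<one>\<^bsub>\<G>\<^esub>"
proof -
  let ?h = "vertex_base (vertex_of e)"
  have h: "?h \<in> angles E" using e by simp
  \<comment> \<open>The base angle has position 0, so its tree path is the walk of the vertex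
    itself.\<close>
  have p: "p (vertex_of e) = vertex_path p ?h" using e by (simp add: vertex_path_def)
  have "vertex_path p e = g_walk E (position e) ?h \<cdot> vertex_path p ?h"
    unfolding p[symmetric] by (simp add: vertex_path_def)
  then have "transport (vertex_path p e) =
      transport (g_walk E (position e) ?h) \<otimes>\<^bsub>\<G>\<^esub> transport (vertex_path p ?h)"
    using h vertex_path_between[OF h] by (simp add: transport_comp walk_between_def)
  then show ?thesis using e h by simp
qed

text \<open>Turning from the base angle up to \<open>e\<close> is trivial, so the next turn has the
  same transport as all turns from the base angle together. These are trivial again, or a complete
  round if \<open>e\<close> is the last angle.\<close>

lemma transport_Act:
  assumes e: "e \<in> angles E"
  shows "transport (g_walk E 1 e) = turn_label \<G> vertex_loop e"
proof -
  let ?h = "vertex_base (vertex_of e)"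
  have h: "?h \<in> angles E" using e by simp
  have "g_walk E (Suc (position e)) ?h = g_walk E 1 e \<cdot> g_walk E (position e) ?h"
    using g_walk_add[OF h, of 1 "position e"] position(2)[OF e] by simp
  then have "transport (g_walk E (Suc (position e)) ?h) = transport (g_walk E 1 e)"
    using e h position(2)[OF e] by (simp add: transport_comp transport_g_walk_position del: g_walk.simps One_nat_def)
  moreover have "transport (g_walk E (Suc (position e)) ?h) = turn_label \<G> vertex_loop e"
  proof (cases "Suc (position e) = card (vertex_of e)")
    case True
    then show ?thesis by (simp add: turn_label_def vertex_loop_def del: g_walk.simps)
  next
    case False
    then have "Suc (position e) < card (vertex_of e)" using position(1)[OF e] by simp
    then have "position (act E 1 e) = Suc (position e)"
      using position_act[OF e, of 1] by simp
    then show ?thesis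
      using transport_g_walk_position[of "act E 1 e"] e False
      by (simp add: turn_label_def del: g_walk.simps)
  qed
  ultimately show ?thesis by simp
qed

text \<open>The step factors through the base angle of the polygon; in the quotient of the two
  polygon paths their common part \<open>?s\<close> cancels.\<close>

lemma transport_Tau:
  assumes eh: "e \<in> angles E" "h \<in> angles E" "polygon E e = polygon E h"
  shows "transport (tau_walk e h) = inv\<^bsub>\<G>\<^esub> edge_loop e \<otimes>\<^bsub>\<G>\<^esub> edge_loop h"
proof -
  let ?c = "polygon_base (polygon E e)" and ?s = "s (polygon E e)"
  have c: "?c \<in> angles E" "polygon E ?c = polygon E e" using eh polygon_in by auto
  have s: "is_walk E ?s" "terminal ?s = ?c"
    using partial_tree_walk(2)[OF tree] eh polygon_in by (auto simp: walk_between_def)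
  have path: "transport (polygon_path s i) = transport (tau_walk i ?c) \<otimes>\<^bsub>\<G>\<^esub> transport ?s"
    if "i \<in> angles E" "polygon E i = polygon E e" for i
    using transport_comp[of "tau_walk i ?c" ?s] that c s by (simp add: polygon_path_def)
  have inv: "transport (tau_walk ?c h) = inv\<^bsub>\<G>\<^esub> transport (tau_walk h ?c)"
    using transport_inv_walk[of "tau_walk h ?c"] eh c by simp
  have "homotopic E (tau_walk e ?c \<cdot> tau_walk ?c h) (tau_walk e h)"
    using eh c by (intro homotopic.h2) auto
  then have "transport (tau_walk e h) = transport (tau_walk e ?c \<cdot> tau_walk ?c h)"
    by (simp add: transport_homotopic)
  also have "\<dots> = transport (tau_walk e ?c) \<otimes>\<^bsub>\<G>\<^esub> inv\<^bsub>\<G>\<^esub> transport (tau_walk h ?c)"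
    using transport_comp[of "tau_walk e ?c" "tau_walk ?c h"] eh c inv by simp
  also have "\<dots> = transport (polygon_path s e) \<otimes>\<^bsub>\<G>\<^esub> inv\<^bsub>\<G>\<^esub> transport (polygon_path s h)"
  proof -
    have cl: "transport (tau_walk e ?c) \<in> carrier \<G>" "transport (tau_walk h ?c) \<in> carrier \<G>"
      "transport ?s \<in> carrier \<G>"
      using eh c s by auto
    then show ?thesis using path[of e] path[of h] eh
      by (simp add: \<G>.inv_mult_group \<G>.m_assoc) (simp add: \<G>.m_assoc[symmetric])
  qed
  also have "\<dots> = inv\<^bsub>\<G>\<^esub> edge_loop e \<otimes>\<^bsub>\<G>\<^esub> edge_loop h"
    using eh polygon_path_between by (simp add: edge_loop_def walk_between_def)
  finally show ?thesis .
qed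

text \<open>Transport is thus itself a labelling of walks, the universal one.\<close>

lemma transport_eq_walk_label:
  "is_walk E w \<Longrightarrow> transport w = walk_label \<G> vertex_loop edge_loop w"
proof (induction w)
  case (Step e \<delta> w)
  let ?s = "Step e \<delta> (Triv (terminal w))"
  have "transport ?s = step_label \<G> vertex_loop edge_loop e \<delta> (terminal w)"
  proof (cases \<delta>)
    case Act
    then show ?thesis using transport_Act[of "terminal w"] Step.prems by simp
  next
    case ActInv
    then have t: "terminal w = act E 1 e" using Step.prems by simp
    then show ?thesis
      using ActInv transport_Act[of e] transport_inv_walk[of "g_walk E 1 e"] Step.prems by simp
  next
    case Tau
    then show ?thesis using transport_Tau Step.prems by simp
  qed
  moreover have "transport (Step e \<delta> w) = transport ?s \<otimes>\<^bsub>\<G>\<^esub> transport w"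
    using transport_comp[of ?s w] Step.prems by simp
  ultimately show ?case using Step by simp
qed simp

end

section \<open>The presentation\<close>

text \<open>
  Arbitrary names for the generators make the same argument yield a presentation over \<^typ>\<open>nat\<close>,
  as demanded by \<^const>\<open>finitely_presented\<close>.
\<close>

definition brauer_gens_on :: "(nat \<Rightarrow> 'x) \<Rightarrow> (nat \<Rightarrow> 'x) \<Rightarrow> nat \<Rightarrow> nat \<Rightarrow> 'x set" where
  "brauer_gens_on A B n r = A ` {1..n} \<union> B ` {1..r}"

definition brauer_rels_on :: "(nat \<Rightarrow> 'x) \<Rightarrow> (nat \<Rightarrow> 'x) \<Rightarrow> nat \<Rightarrow> nat \<Rightarrow> (nat \<Rightarrow> nat) \<Rightarrow>
    ('x word set \<times> 'x word set) set" where
  "brauer_rels_on A B n r d =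
     (let F = free_group (brauer_gens_on A B n r);
          a = (\<lambda>i. free_gen (brauer_gens_on A B n r) (A i));
          b = (\<lambda>j. free_gen (brauer_gens_on A B n r) (B j))
      in {(a i [^]\<^bsub>F\<^esub> d i, a (Suc i) [^]\<^bsub>F\<^esub> d (Suc i)) | i. 1 \<le> i \<and> i < n} \<union>
         {(a 1 [^]\<^bsub>F\<^esub> d 1 \<otimes>\<^bsub>F\<^esub> b j, b j \<otimes>\<^bsub>F\<^esub> a 1 [^]\<^bsub>F\<^esub> d 1) | j. 1 \<le> j \<and> j \<le> r})"

lemma brauer_gens_eq: "brauer_gens n r = brauer_gens_on GenA GenB n r"
  by (simp add: brauer_gens_def brauer_gens_on_def)

lemma brauer_rels_eq: "brauer_rels n r d = brauer_rels_on GenA GenB n r d"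
  by (simp add: brauer_rels_def brauer_rels_on_def brauer_gens_eq)

text \<open>\<open>1 \<le> n\<close> makes \<open>A 1\<close>, which the commutation relations
  mention, a generator.\<close>

lemma presentation_brauer:
  assumes "1 \<le> n"
  shows "presentation (brauer_gens_on A B n r) (brauer_rels_on A B n r d)"
proof
  let ?S = "brauer_gens_on A B n r"
  interpret F: group "free_group ?S" by (rule group_free_group)
  have "free_gen ?S (A i) \<in> carrier (free_group ?S)" if "1 \<le> i" "i \<le> n" for i
    using that by (auto simp: brauer_gens_on_def)
  moreover have "free_gen ?S (B j) \<in> carrier (free_group ?S)" if "1 \<le> j" "j \<le> r" for j
    using that by (auto simp: brauer_gens_on_def)
  ultimately show "brauer_rels_on A B n r d \<subseteq> carrier (free_group ?S) \<times> carrier (free_group ?S)"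
    using assms unfolding brauer_rels_on_def Let_def by auto
qed

lemma finite_brauer_rels: "finite (brauer_rels_on A B n r d)"
proof -
  have "{f i | i. 1 \<le> i \<and> i < n} = f ` {1..<n}" "{f i | i. 1 \<le> i \<and> i \<le> n} = f ` {1..n}"
    for f :: "nat \<Rightarrow> 'z" and n
    by auto
  then show ?thesis unfolding brauer_rels_on_def Let_def by simp
qed

context spanned_brauer_configuration
begin

text \<open>Labels give \<open>\<phi>\<close> and von Dyck's theorem gives \<open>\<psi>\<close>.
  Injective names with disjoint ranges let the images of the generators be prescribed
  independently.\<close>

lemma fundamental_group_iso:
  fixes A B :: "nat \<Rightarrow> 'x"
  assumes A: "inj A" and B: "inj B" and AB: "range A \<inter> range B = {}"
    and v: "bij_betw v {1..n} (vertices E)"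
    and d: "\<And>i. i \<in> {1..n} \<Longrightarrow> d i = vertex_degree (v i)"
    and r: "r = card (angles E - T)"
  shows "fundamental_group E b \<cong>
    presented_group (brauer_gens_on A B n r) (brauer_rels_on A B n r d)"
proof -
  let ?S = "brauer_gens_on A B n r" and ?R = "brauer_rels_on A B n r d"
  have "vertices E \<noteq> {}" using base_angle by (auto simp: vertices_eq)
  then have n: "1 \<le> n" using v by (auto simp: bij_betw_def)
  interpret pres: presentation ?S ?R by (rule presentation_brauer[OF n])
  have v_in: "v i \<in> vertices E" if "i \<in> {1..n}" for i using v that by (auto simp: bij_betw_def)
  obtain \<epsilon> where \<epsilon>: "bij_betw \<epsilon> {1..r} (angles E - T)"
    using ex_bij_betw_nat_finite_1[of "angles E - T"] finite_angles r by auto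
  have \<epsilon>_in: "\<epsilon> j \<in> angles E - T" if "j \<in> {1..r}" for j using \<epsilon> that by (auto simp: bij_betw_def)
  define \<alpha> where "\<alpha> i = pres.\<pi> (free_gen ?S (A i))" for i
  define \<beta> where "\<beta> j = pres.\<pi> (free_gen ?S (B j))" for j
  have A_in: "A i \<in> ?S" if "i \<in> {1..n}" for i using that by (auto simp: brauer_gens_on_def)
  have B_in: "B j \<in> ?S" if "j \<in> {1..r}" for j using that by (auto simp: brauer_gens_on_def)
  have \<alpha>_closed: "\<alpha> i \<in> carrier pres.P" if "i \<in> {1..n}" for i
    using that A_in by (simp add: \<alpha>_def)
  have \<beta>_closed: "\<beta> j \<in> carrier pres.P" if "j \<in> {1..r}" for j
    using that B_in by (simp add: \<beta>_def)
  have \<alpha>_pow: "\<alpha> i [^]\<^bsub>pres.P\<^esub> k = pres.\<pi> (free_gen ?S (A i) [^]\<^bsub>pres.F\<^esub> k)"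
    if "i \<in> {1..n}" for i and k :: nat
    using that A_in by (simp add: \<alpha>_def pres.proj.hom_nat_pow)
  define z where "z = \<alpha> 1 [^]\<^bsub>pres.P\<^esub> d 1"
  \<comment> \<open>Each relation equates two neighbouring powers; the chain starts at index
    1.\<close>
  have \<alpha>_z: "\<alpha> i [^]\<^bsub>pres.P\<^esub> d i = z" if "1 \<le> i" "i \<le> n" for i
    using that
  proof (induction i rule: dec_induct)
    case base
    then show ?case by (simp add: z_def)
  next
    case (step i)
    then have "(free_gen ?S (A i) [^]\<^bsub>pres.F\<^esub> d i, free_gen ?S (A (Suc i)) [^]\<^bsub>pres.F\<^esub> d (Suc i)) \<in> ?R"
      unfolding brauer_rels_on_def Let_def by auto
    from pres.proj_rel[OF this] show ?case
      using step \<alpha>_pow[of i] \<alpha>_pow[of "Suc i"] by simp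
  qed
  have z_\<beta>: "z \<otimes>\<^bsub>pres.P\<^esub> \<beta> j = \<beta> j \<otimes>\<^bsub>pres.P\<^esub> z" if "j \<in> {1..r}" for j
  proof -
    have "(free_gen ?S (A 1) [^]\<^bsub>pres.F\<^esub> d 1 \<otimes>\<^bsub>pres.F\<^esub> free_gen ?S (B j),
        free_gen ?S (B j) \<otimes>\<^bsub>pres.F\<^esub> free_gen ?S (A 1) [^]\<^bsub>pres.F\<^esub> d 1) \<in> ?R"
      using that unfolding brauer_rels_on_def Let_def by auto
    from pres.proj_rel[OF this] show ?thesis
      using n A_in[of 1] B_in[OF that] \<alpha>_pow[of 1 "d 1"] by (simp add: z_def \<beta>_def)
  qed
  define a where "a u = \<alpha> (inv_into {1..n} v u)" for u
  \<comment> \<open>Angles of the tree get no generator: crossing them is trivial.\<close>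
  define y where "y e = (if e \<in> T then \<one>\<^bsub>pres.P\<^esub> else \<beta> (inv_into {1..r} \<epsilon> e))" for e
  have idx_v: "inv_into {1..n} v u \<in> {1..n} \<and> v (inv_into {1..n} v u) = u" if "u \<in> vertices E" for u
    using that v by (metis bij_betw_def f_inv_into_f inv_into_into)
  have idx_\<epsilon>: "inv_into {1..r} \<epsilon> e \<in> {1..r} \<and> \<epsilon> (inv_into {1..r} \<epsilon> e) = e"
    if "e \<in> angles E" "e \<notin> T" for e
    using that \<epsilon> by (metis DiffI bij_betw_def f_inv_into_f inv_into_into)
  have a_v: "a (v i) = \<alpha> i" if "i \<in> {1..n}" for i
    using that v by (simp add: a_def bij_betw_def)
  have y_\<epsilon>: "y (\<epsilon> j) = \<beta> j" if "j \<in> {1..r}" for j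
    using that \<epsilon> \<epsilon>_in[OF that] by (simp add: y_def bij_betw_def)
  interpret lab: pointed_labelling E pres.P a y z b
  proof unfold_locales
    show "a u \<in> carrier pres.P" if "u \<in> vertices E" for u
      using idx_v[OF that] \<alpha>_closed by (simp add: a_def)
    show "y e \<in> carrier pres.P" if "e \<in> angles E" for e
      using idx_\<epsilon>[OF that] \<beta>_closed by (simp add: y_def)
    show "a u [^]\<^bsub>pres.P\<^esub> vertex_degree u = z" if "u \<in> vertices E" for u
      using idx_v[OF that] \<alpha>_z[of "inv_into {1..n} v u"] d[of "inv_into {1..n} v u"]
      by (simp add: a_def)
    show "z \<otimes>\<^bsub>pres.P\<^esub> y e = y e \<otimes>\<^bsub>pres.P\<^esub> z" if "e \<in> angles E" for e
      using idx_\<epsilon>[OF that] z_\<beta>[of "inv_into {1..r} \<epsilon> e"] \<alpha>_closed[of 1] n by (simp add: y_def z_def)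
  qed
  have y_T: "y e = \<one>\<^bsub>pres.P\<^esub>" if "e \<in> T" for e using that by (simp add: y_def)
  note tree_label = lab.partial_tree_label[OF tree y_T]
  have label_vertex_path: "lab.label (vertex_path p e) = \<one>\<^bsub>pres.P\<^esub>" if e: "e \<in> angles E" for e
    using e tree_label(1)[of "vertex_of e"] partial_tree_walk(1)[OF tree, of "vertex_of e"]
    by (simp add: vertex_path_def lab.label_comp walk_between_def vertices_eq)
  have label_polygon_path: "lab.label (polygon_path s e) = inv\<^bsub>pres.P\<^esub> y e" if e: "e \<in> angles E" for e
    using e tree_label(2)[of "polygon E e"] partial_tree_walk(2)[OF tree, of "polygon E e"] polygon_in[OF e]
    by (simp add: polygon_path_def walk_between_def lab.y_closed pres.P.m_assoc)
  obtain \<phi> where \<phi>: "\<phi> \<in> hom \<G> pres.P"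
    and \<phi>_class: "\<And>w. \<lbrakk>is_walk E w; source w = b; terminal w = b\<rbrakk> \<Longrightarrow> \<phi> (hclass w) = lab.label w"
    using lab.label_induces_hom[OF base_angle] by blast
  \<comment> \<open>The tree paths have label one, so closing up a walk along them does not change
    its label.\<close>
  have \<phi>_transport: "\<phi> (transport w) = lab.label w" if w: "is_walk E w" for w
  proof -
    note q = vertex_path_between[unfolded walk_between_def]
    have "\<phi> (transport w) =
        lab.label (inv_walk (vertex_path p (terminal w)) \<cdot> (w \<cdot> vertex_path p (source w)))"
      unfolding transport_def using w q by (intro \<phi>_class) auto
    also have "\<dots> = lab.label w"
      using w q by (simp add: lab.label_comp lab.label_inv_walk label_vertex_path)
    finally show ?thesis .
  qed
  define f where "f x = (if x \<in> A ` {1..n} then vertex_loop (v (inv_into {1..n} A x))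
    else edge_loop (\<epsilon> (inv_into {1..r} B x)))" for x
  have f_A: "f (A i) = vertex_loop (v i)" if "i \<in> {1..n}" for i
    using that inj_on_subset[OF A subset_UNIV] by (simp add: f_def)
  have f_B: "f (B j) = edge_loop (\<epsilon> j)" if "j \<in> {1..r}" for j
    using that inj_on_subset[OF B subset_UNIV] AB by (auto simp: f_def)
  have f: "f \<in> ?S \<rightarrow> carrier \<G>"
    using f_A f_B v_in \<epsilon>_in vertex_loop_closed edge_loop_closed by (auto simp: brauer_gens_on_def)
  obtain h where h: "h \<in> hom pres.F \<G>" "\<And>x. x \<in> ?S \<Longrightarrow> h (free_gen ?S x) = f x"
    using \<G>.free_group_lift[OF f] by blast
  interpret h: group_hom pres.F \<G> h using h(1) by unfold_locales
  have h_pow: "h (free_gen ?S (A i) [^]\<^bsub>pres.F\<^esub> d i) = full_turn b" if "i \<in> {1..n}" for i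
    using that A_in[OF that] h(2) f_A d vertex_loop_pow[OF v_in[OF that]] by (simp add: h.hom_nat_pow)
  have h_rel: "h x = h x'" if "(x, x') \<in> ?R" for x x'
    using that unfolding brauer_rels_on_def Let_def
  proof (elim UnE CollectE exE conjE)
    fix i assume "(x, x') = (free_gen ?S (A i) [^]\<^bsub>pres.F\<^esub> d i,
        free_gen ?S (A (Suc i)) [^]\<^bsub>pres.F\<^esub> d (Suc i))" "1 \<le> i" "i < n"
    then show ?thesis using h_pow[of i] h_pow[of "Suc i"] by simp
  next
    fix j assume "(x, x') = (free_gen ?S (A 1) [^]\<^bsub>pres.F\<^esub> d 1 \<otimes>\<^bsub>pres.F\<^esub> free_gen ?S (B j),
        free_gen ?S (B j) \<otimes>\<^bsub>pres.F\<^esub> free_gen ?S (A 1) [^]\<^bsub>pres.F\<^esub> d 1)" "1 \<le> j" "j \<le> r"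
    then show ?thesis
      using h_pow[of 1] n A_in[of 1] B_in[of j] full_turn_central[of "h (free_gen ?S (B j))"] by simp
  qed
  obtain \<psi> where \<psi>: "\<psi> \<in> hom pres.P \<G>" "\<And>x. x \<in> carrier pres.F \<Longrightarrow> \<psi> (pres.\<pi> x) = h x"
    using pres.lift[OF \<G>.is_group h(1) h_rel] by blast
  interpret \<psi>: group_hom pres.P \<G> \<psi> using \<psi>(1) by unfold_locales
  have \<psi>_\<alpha>: "\<psi> (\<alpha> i) = vertex_loop (v i)" if "i \<in> {1..n}" for i
    using that A_in h(2) f_A \<psi>(2) by (simp add: \<alpha>_def)
  have \<psi>_\<beta>: "\<psi> (\<beta> j) = edge_loop (\<epsilon> j)" if "j \<in> {1..r}" for j
    using that B_in h(2) f_B \<psi>(2) by (simp add: \<beta>_def)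
  \<comment> \<open>\<open>\<psi>\<close> sends \<open>a\<close> and \<open>y\<close> to the loops
    whose labelling is transport; on \<open>T\<close> this holds because both sides are one.\<close>
  have \<psi>_label: "\<psi> (lab.label w) = transport w" if "is_walk E w" for w
  proof -
    have "\<psi> (a u) = vertex_loop u" if "u \<in> vertices E" for u
      using idx_v[OF that] \<psi>_\<alpha> by (simp add: a_def)
    moreover have "\<psi> (y e) = edge_loop e" if "e \<in> angles E" for e
      using idx_\<epsilon>[OF that] \<psi>_\<beta> edge_loop_tree by (simp add: y_def)
    ultimately show ?thesis
      using hom_walk_label[OF \<psi>.group_hom_axioms lab.a_closed lab.y_closed _ _ that]
      by (simp add: transport_eq_walk_label[OF that])
  qed
  show ?thesis
  proof (rule pres.iso_of_inverse_on_gens[OF \<G>.is_group \<phi> \<psi>(1)])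
    show "\<psi> (\<phi> x) = x" if "x \<in> carrier \<G>" for x
      using that
    proof (rule fundamental_group_carrierE)
      fix w assume "is_walk E w" "source w = b" "terminal w = b" "x = hclass w"
      then show ?thesis using \<psi>_label \<phi>_class transport_closed_walk by simp
    qed
  next
    fix x assume "x \<in> ?S"
    then consider i where "i \<in> {1..n}" "x = A i" | j where "j \<in> {1..r}" "x = B j"
      by (auto simp: brauer_gens_on_def)
    then show "\<phi> (\<psi> (pres.\<pi> (free_gen ?S x))) = pres.\<pi> (free_gen ?S x)"
    proof cases
      case 1
      obtain e where e: "e \<in> angles E" "v i = vertex_of e" using v_in[OF 1(1)] by (auto simp: vertices_eq)
      \<comment> \<open>One round from the base angle has exponent
        \<open>card (v i) div card (v i)\<close>, that is 1.\<close>
      have "\<phi> (vertex_loop (v i)) = a (v i)"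
        using e card_vertex_pos[OF e(1)] lab.a_closed[OF v_in[OF 1(1)]]
        by (simp add: vertex_loop_def \<phi>_transport lab.label_g_walk)
      then show ?thesis using 1 \<psi>_\<alpha> a_v by (simp add: \<alpha>_def)
    next
      case 2
      have "\<epsilon> j \<in> angles E" using \<epsilon>_in[OF 2(1)] by simp
      \<comment> \<open>The inverse in \<open>edge_loop\<close> undoes the one in
        \<open>label_polygon_path\<close>.\<close>
      then have "\<phi> (edge_loop (\<epsilon> j)) = y (\<epsilon> j)"
        using polygon_path_between[of "\<epsilon> j"]
        by (simp add: edge_loop_def walk_between_def \<phi>_transport lab.label_inv_walk label_polygon_path
            lab.y_closed flip: transport_inv_walk)
      then show ?thesis using 2 \<psi>_\<beta> y_\<epsilon> by (simp add: \<beta>_def)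
    qed
  qed
qed

end

section \<open>Counting angles by polygon size\<close>

context brauer_configuration
begin

lemma card_angles: "card (angles E) = (\<Sum>p \<in> polygons E. card p)"
  using card_Union_disjoint[of "polygons E"] partition_onD1[OF partition_P]
    partition_onD2[OF partition_P] finite_angles
  by (metis Sup_upper finite_subset)

lemma sum_polygon_sizes:
  assumes k: "\<And>l. l \<ge> 2 \<Longrightarrow> k l = card {p \<in> polygons E. card p = l}"
  shows "(\<Sum>l | l \<ge> 2 \<and> k l \<noteq> 0. (int l - 1) * int (k l)) = int (card (angles E)) - int (card (polygons E))"
proof -
  have fin: "finite (polygons E)" by (rule finite_elements[OF finite_angles partition_P])
  have two: "2 \<le> card p" if "p \<in> polygons E" for p
  proof -
    have "p \<noteq> {}" "finite p"
      using that partition_onD3[OF partition_P] partition_onD1[OF partition_P] finite_angles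
      by (auto intro: finite_subset)
    then have "card p \<noteq> 0" by simp
    then show ?thesis using no_1_gon[OF that] by linarith
  qed
  \<comment> \<open>Only sizes that occur are summed, which keeps the index set finite; a sum over
    an infinite set would be 0.\<close>
  have sizes: "{l. l \<ge> 2 \<and> k l \<noteq> 0} = card ` polygons E"
  proof (intro equalityI subsetI)
    fix l assume "l \<in> {l. l \<ge> 2 \<and> k l \<noteq> 0}"
    then have "card {p \<in> polygons E. card p = l} \<noteq> 0" using k[of l] by auto
    then have "{p \<in> polygons E. card p = l} \<noteq> {}" by (metis card.empty)
    then show "l \<in> card ` polygons E" by auto
  next
    fix l assume "l \<in> card ` polygons E"
    then obtain p where p: "p \<in> polygons E" "l = card p" by auto
    then have "{p \<in> polygons E. card p = l} \<noteq> {}" by auto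
    then have "k l \<noteq> 0" using k[of l] two p fin by simp
    then show "l \<in> {l. l \<ge> 2 \<and> k l \<noteq> 0}" using two p by simp
  qed
  have "int (card (angles E)) - int (card (polygons E)) = (\<Sum>p\<in>polygons E. int (card p) - 1)"
    by (simp add: card_angles sum_subtractf)
  also have "\<dots> = (\<Sum>l\<in>card ` polygons E. \<Sum>p | p \<in> polygons E \<and> card p = l. int (card p) - 1)"
    by (rule sum.image_gen[OF fin])
  also have "\<dots> = (\<Sum>l\<in>card ` polygons E. (int l - 1) * int (k l))"
  proof (rule sum.cong[OF HOL.refl])
    fix l assume "l \<in> card ` polygons E"
    then have "2 \<le> l" using two by auto
    then show "(\<Sum>p | p \<in> polygons E \<and> card p = l. int (card p) - 1) = (int l - 1) * int (k l)"
      by (simp add: k mult.commute)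
  qed
  finally show ?thesis unfolding sizes by simp
qed

end

theorem theorem1p9:
  fixes E :: "'a fbc" and n :: nat and v :: "nat \<Rightarrow> 'a set"
    and k d :: "nat \<Rightarrow> nat" and r :: int and e :: 'a
  assumes "brauer_configuration E"
    and "connected_fbc E"
    and "bij_betw v {1..n} (vertices E)"
    and "\<And>l. l \<ge> 2 \<Longrightarrow> k l = card {p \<in> polygons E. card p = l}"
    and "\<And>i. i \<in> {1..n} \<Longrightarrow> of_nat (d i) = f_degree E (v i)"
    and "r = (\<Sum>l | l \<ge> 2 \<and> k l \<noteq> 0. (int l - 1) * int (k l)) - int n + 1"
    and "e \<in> angles E"
  shows "0 \<le> r \<and>
    fundamental_group E e \<cong>
      presented_group (brauer_gens n (nat r)) (brauer_rels n (nat r) d) \<and>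
    finitely_presented (fundamental_group E e)"
proof -
  interpret brauer_configuration E by fact
  interpret pointed_brauer_configuration E e by unfold_locales fact
  obtain T p s where "partial_tree (vertices E) (polygons E) T p s"
    using spanning_tree_exists[OF assms(2)] by blast
  then interpret spanned_brauer_configuration E e T p s by unfold_locales
  have "card (vertices E) = n" using bij_betw_same_card[OF assms(3)] by simp
  moreover have "card T \<le> card (angles E)"
    using partial_tree_subset(3)[OF tree] finite_angles by (intro card_mono)
  moreover have "card (angles E - T) = card (angles E) - card T"
    using partial_tree_subset(3)[OF tree] partial_tree_finite(3)[OF tree] by (rule card_Diff_subset[rotated])
  \<comment> \<open>The tree has n + |P| - 1 angles and the sum is |E| - |P|. Being a cardinality,
    \<open>r\<close> is nonnegative.\<close>
  ultimately have r: "r = int (card (angles E - T))"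
    using partial_tree_card[OF tree] sum_polygon_sizes[OF assms(4)] assms(6) by linarith
  have deg: "d i = vertex_degree (v i)" if "i \<in> {1..n}" for i
  proof -
    have "v i \<in> vertices E" using assms(3) that by (auto simp: bij_betw_def)
    then obtain h where "h \<in> angles E" "v i = vertex_of h" by (auto simp: vertices_eq)
    then have "(of_nat (d i) :: rat) = of_nat (vertex_degree (v i))"
      using assms(5)[OF that] f_degree_eq by simp
    then show ?thesis by simp
  qed
  \<comment> \<open>The type of names is left open, to be used for both \<open>gen\<close> and
    \<open>nat\<close>.\<close>
  have iso: "fundamental_group E e \<cong>
      presented_group (brauer_gens_on A B n (nat r)) (brauer_rels_on A B n (nat r) d)"
    if "inj A" "inj B" "range A \<inter> range B = {}" for A B :: "nat \<Rightarrow> 'x"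
    using fundamental_group_iso[OF that assms(3) deg, of "nat r"] r by simp
  have gen: "fundamental_group E e \<cong> presented_group (brauer_gens n (nat r)) (brauer_rels n (nat r) d)"
    unfolding brauer_gens_eq brauer_rels_eq by (rule iso) (auto simp: inj_def)
  \<comment> \<open>Even and odd numbers keep the two families of generators apart inside
    \<open>nat\<close>.\<close>
  let ?A = "\<lambda>i::nat. 2 * i" and ?B = "\<lambda>i::nat. 2 * i + 1"
  let ?S = "brauer_gens_on ?A ?B n (nat r)" and ?R = "brauer_rels_on ?A ?B n (nat r) d"
  have "fundamental_group E e \<cong> presented_group ?S ?R"
    by (rule iso) (auto simp: inj_def, presburger)
  moreover have "finite ?S" by (simp add: brauer_gens_on_def)
  moreover have "?R \<subseteq> carrier (free_group ?S) \<times> carrier (free_group ?S)"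
  proof -
    have "1 \<le> n" using assms(3,7) by (auto simp: bij_betw_def vertices_eq)
    then show ?thesis by (rule presentation.rels[OF presentation_brauer])
  qed
  ultimately have "finitely_presented (fundamental_group E e)"
    unfolding finitely_presented_def
    by (intro exI[of _ ?S] exI[of _ ?R] conjI finite_brauer_rels)
  with gen r show ?thesis by simp
qed

end
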